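(* For every finite coloring of $\mathbb{N}$ there exist a color class $A \subseteq \mathbb{N}$ and functions \[ \alpha, \beta: \mathcal{P}_{f}\left({}^{\mathbb{N}}\mathbb{N}\right)\rightarrow \mathbb{N} \quad \text{and} \quad H: \mathcal{P}_f\left({}^{\mathbb{N}}\mathbb{N}\right) \to \mathcal{P}_f(\mathbb{N}) \] such that: (1) If $F, G \in \mathcal{P}_{f}\left({}^{\mathbb{N}}\mathbb{N}\right)$ and $F \subsetneq G$, then $\max H(F) < \min H(G)$. (2) For any $m \in \mathbb{N}$, any $G_1 \subsetneq G_2 \subsetneq \dots \subsetneq G_m$ in $\mathcal{P}_{f}\left({}^{\mathbb{N}}\mathbb{N}\right)$, and any choice of $f_i \in G_i$ for $i = 1, 2, \dots, m$, we have: (a) $\displaystyle \sum_{i=1}^{m} \left( \alpha(G_i) + \sum_{t \in H(G_i)} f_i(t) \right) \in A$; (b) $\displaystyle \prod_{i=1}^{m} \left( \beta(G_i) \cdot \prod_{t \in H(G_i)} f_i(t) \right) \in A$; (c) for all $N \in \mathbb{N}$ with $N \leq m$, \[ \left( \sum_{i=1}^{N} \left( \alpha(G_i) + \sum_{t \in H(G_i)} f_i(t) \right) \right) \cdot \left( \prod_{i=N+1}^{m} \left( \beta(G_i) \cdot \prod_{t \in H(G_i)} f_i(t) \right) \right) \in A. \]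
   Context: $\mathbb{N}$ denotes the set of positive integers. For a nonempty set $X$, $\mathcal{P}_f(X)$ denotes the collection of all nonempty finite subsets of $X$, and ${}^{\mathbb{N}}X$ denotes the set of all sequences in $X$ (functions $\mathbb{N}\to X$). A finite coloring of $\mathbb{N}$ is a partition of $\mathbb{N}$ into finitely many sets (color classes). An empty product is interpreted as $1$. *)

theory Defs
  imports Main "HOL-Library.FuncSet" "HOL-Library.Disjoint_Sets"
begin

text \<open>The positive integers are the subset \<open>{1..}\<close> of type \<^typ>\<open>nat\<close>.\<close>

abbreviation Npos :: "nat set" where
  "Npos \<equiv> {1..}"

definition fin_subsets :: "'a set \<Rightarrow> 'a set set" where
  "fin_subsets X = Fpow X - {{}}"

text \<open>Sequences are extensional functions: they are pinned to \<^const>\<open>undefined\<close> at the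
  index 0, so that two sequences agreeing on all positive indices are equal.  Strict inclusion
  between finite sets of sequences would otherwise be affected by the value at 0.\<close>

definition seqs :: "'a set \<Rightarrow> (nat \<Rightarrow> 'a) set" where
  "seqs X = Npos \<rightarrow>\<^sub>E X"

definition finite_coloring :: "nat set set \<Rightarrow> bool" where
  "finite_coloring C \<longleftrightarrow> finite C \<and> partition_on Npos C"

end

theory Submission
  imports Defs
begin

text \<open>Call a set rich if, for every \<open>k\<close>, any \<open>k\<close> sequences have a common translate of their sums
  over some \<open>H \<subseteq> {..<r}\<close> inside the set, with \<open>r\<close> depending on \<open>k\<close> only.  By the Hales--Jewett
  theorem richness is partition regular, for addition and for multiplication, so there are
  idempotent ultrafilters consisting of rich sets.  Dilations preserve additive richness; hence the
  sets that belong to all additive idempotents of this kind form a filter that is closed under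
  dilations, and some multiplicative idempotent \<open>p\<close> of rich sets extends that filter.  If \<open>A\<close> is
  the colour in \<open>p\<close> and \<open>A'\<close> the set of \<open>x \<in> A\<close> with \<open>A / x \<in> p\<close>, then \<open>A' \<in> p\<close>, so \<open>A'\<close>
  also belongs to an additive idempotent \<open>q\<close>.  The functions are chosen recursively along
  strict inclusion, keeping the sums in the subset of \<open>A'\<close> that \<open>q\<close> makes stable under addition
  and all products in \<open>A'\<close>.  A single \<open>H\<close> serves both operations, because richness for one of
  them can be applied to blocks provided by richness for the other.\<close>


section \<open>The Hales--Jewett theorem\<close>

text \<open>A variable word is a list of options; \<^const>\<open>None\<close> marks the variable positions.\<close>

definition fill :: "'a \<Rightarrow> 'a option list \<Rightarrow> 'a list" where
  "fill a l = map (case_option a id) l"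

definition words :: "nat \<Rightarrow> nat \<Rightarrow> nat list set" where
  "words k n = {w. length w = n \<and> set w \<subseteq> {..<k}}"

definition var_words :: "nat \<Rightarrow> nat \<Rightarrow> nat option list set" where
  "var_words k n = {l. length l = n \<and> None \<in> set l \<and> set l \<subseteq> insert None (Some ` {..<k})}"

definition monochromatic_line :: "nat \<Rightarrow> nat \<Rightarrow> (nat list \<Rightarrow> nat) \<Rightarrow> bool" where
  "monochromatic_line k n \<chi> \<longleftrightarrow> (\<exists>l \<in> var_words k n. \<exists>\<gamma>. \<forall>a<k. \<chi> (fill a l) = \<gamma>)"

definition hales_jewett :: "nat \<Rightarrow> nat \<Rightarrow> nat \<Rightarrow> bool" where
  "hales_jewett k c n \<longleftrightarrow> (\<forall>\<chi>. (\<forall>w \<in> words k n. \<chi> w < c) \<longrightarrow> monochromatic_line k n \<chi>)"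

lemma finite_words: "finite (words k n)"
proof -
  have "words k n = {w. set w \<subseteq> {..<k} \<and> length w = n}"
    by (auto simp: words_def)
  then show ?thesis
    using finite_lists_length_eq[of "{..<k}" n] by simp
qed

lemma fill_append: "fill a (l @ l') = fill a l @ fill a l'"
  by (simp add: fill_def)

lemma fill_map_Some: "fill a (map Some w) = w"
  by (simp add: fill_def comp_def)

lemma fill_in_words: "l \<in> var_words k n \<Longrightarrow> a < k \<Longrightarrow> fill a l \<in> words k n"
  by (force simp: var_words_def words_def fill_def split: option.splits)

lemma words_mono: "k \<le> k' \<Longrightarrow> words k n \<subseteq> words k' n"
  by (force simp: words_def)

lemma var_words_mono: "k \<le> k' \<Longrightarrow> var_words k n \<subseteq> var_words k' n"
  by (force simp: var_words_def)

lemma words_append: "w \<in> words k n \<Longrightarrow> w' \<in> words k n' \<Longrightarrow> w @ w' \<in> words k (n + n')"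
  by (auto simp: words_def)

lemma var_words_append:
  "l \<in> var_words k n \<Longrightarrow> l' \<in> var_words k n' \<Longrightarrow> l @ l' \<in> var_words k (n + n')"
  by (auto simp: var_words_def)

lemma var_words_append_word:
  "l \<in> var_words k n \<Longrightarrow> w \<in> words k n' \<Longrightarrow> l @ map Some w \<in> var_words k (n + n')"
  by (auto simp: var_words_def words_def)

lemma word_append_var_words:
  "w \<in> words k n \<Longrightarrow> l \<in> var_words k n' \<Longrightarrow> map Some w @ l \<in> var_words k (n + n')"
  by (auto simp: var_words_def words_def)

section \<open>Colour focusing\<close>

text \<open>Indexing the lines by their colours keeps these colours distinct, so
  \<open>card Cs\<close> counts lines. The fillings with old letters, those below \<open>k\<close>,
  are monochromatic; the new letter \<open>k\<close> leads all lines to the same word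
  \<open>f\<close>, the focus.\<close>

definition focused_lines :: "nat \<Rightarrow> nat \<Rightarrow> nat \<Rightarrow> (nat list \<Rightarrow> nat) \<Rightarrow> nat set \<Rightarrow> bool" where
  "focused_lines k n c \<chi> Cs \<longleftrightarrow> Cs \<subseteq> {..<c} \<and>
     (\<exists>f \<in> words (Suc k) n. \<forall>\<gamma> \<in> Cs. \<exists>l \<in> var_words (Suc k) n.
        fill k l = f \<and> (\<forall>a<k. \<chi> (fill a l) = \<gamma>))"

text \<open>A word \<open>u\<close> of length \<open>n'\<close> is coloured by the whole colouring
  sending \<open>v\<close> to \<open>\<chi> (u @ v)\<close>. The hypothesis for \<open>k\<close>
  letters then gives a line \<open>L\<close> whose fillings with letters below \<open>k\<close> are
  not told apart by any tail \<open>v\<close>. Focused lines found among the tails are prolonged by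
  \<open>L\<close>, and \<open>L\<close> itself supplies one more colour.\<close>

lemma colour_focusing:
  assumes k: "k \<ge> 1" and hj: "\<And>c. \<exists>n. hales_jewett k c n"
  shows "\<exists>n. \<forall>\<chi>. (\<forall>w \<in> words (Suc k) n. \<chi> w < c) \<longrightarrow>
           monochromatic_line (Suc k) n \<chi> \<or> (\<exists>Cs. card Cs = m \<and> focused_lines k n c \<chi> Cs)"
proof (induction m)
  case 0
  have "focused_lines k 0 c \<chi> {}" for \<chi>
    by (auto simp: focused_lines_def words_def)
  then show ?case
    by (metis card.empty)
next
  case (Suc m)
  then obtain n where n: "\<And>\<chi>. (\<forall>w \<in> words (Suc k) n. \<chi> w < c) \<Longrightarrow>
      monochromatic_line (Suc k) n \<chi> \<or> (\<exists>Cs. card Cs = m \<and> focused_lines k n c \<chi> Cs)"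
    by blast
  define W where "W = words (Suc k) n"
  \<comment> \<open>The colours of prefixes are colourings of the tails; \<open>h\<close> numbers
    them, because \<open>hales_jewett\<close> speaks of natural numbers as colours.\<close>
  define Fn where "Fn = W \<rightarrow>\<^sub>E {..<c}"
  have "finite Fn"
    unfolding Fn_def W_def by (intro finite_PiE finite_words) auto
  then obtain h where h: "bij_betw h Fn {0..<card Fn}"
    using ex_bij_betw_finite_nat by blast
  obtain n' where n': "hales_jewett k (card Fn) n'"
    using hj by blast
  have "monochromatic_line (Suc k) (n' + n) \<chi> \<or>
      (\<exists>Cs. card Cs = Suc m \<and> focused_lines k (n' + n) c \<chi> Cs)"
    if \<chi>: "\<forall>w \<in> words (Suc k) (n' + n). \<chi> w < c" for \<chi>
  proof -
    define \<chi>' where "\<chi>' u = h (restrict (\<lambda>v. \<chi> (u @ v)) W)" for u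
    have Fn: "restrict (\<lambda>v. \<chi> (u @ v)) W \<in> Fn" if "u \<in> words (Suc k) n'" for u
      using \<chi> words_append[OF that] unfolding Fn_def W_def by auto
    have sub: "words k n' \<subseteq> words (Suc k) n'" "var_words k n' \<subseteq> var_words (Suc k) n'"
      by (simp_all add: words_mono var_words_mono)
    have "\<forall>u \<in> words k n'. \<chi>' u < card Fn"
      using Fn sub h unfolding \<chi>'_def bij_betw_def by (metis atLeastLessThan_iff image_eqI subsetD)
    then obtain L \<gamma>' where L: "L \<in> var_words k n'" and \<gamma>': "\<And>a. a < k \<Longrightarrow> \<chi>' (fill a L) = \<gamma>'"
      using n' unfolding hales_jewett_def monochromatic_line_def by blast
    have LS: "L \<in> var_words (Suc k) n'"
      using L sub by blast
    have Lw: "fill a L \<in> words (Suc k) n'" if "a \<le> k" for a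
      using fill_in_words[OF LS] that by auto
    have same: "\<chi> (fill a L @ v) = \<chi> (fill 0 L @ v)" if "a < k" "v \<in> W" for a v
    proof -
      have "\<chi>' (fill a L) = \<chi>' (fill 0 L)"
        using \<gamma>' that k by simp
      then have "restrict (\<lambda>v. \<chi> (fill a L @ v)) W = restrict (\<lambda>v. \<chi> (fill 0 L @ v)) W"
        using h Fn Lw that k unfolding \<chi>'_def bij_betw_def inj_on_def by (meson less_imp_le zero_le)
      then show ?thesis
        using that by (metis restrict_apply')
    qed
    define \<chi>0 where "\<chi>0 v = \<chi> (fill 0 L @ v)" for v
    have \<chi>0: "\<forall>v \<in> words (Suc k) n. \<chi>0 v < c"
      using \<chi> Lw words_append unfolding \<chi>0_def by blast
    have mono: "monochromatic_line (Suc k) (n' + n) \<chi>"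
      if l: "l \<in> var_words (Suc k) n" and "\<forall>a<Suc k. \<chi>0 (fill a l) = \<gamma>" for l \<gamma>
    proof -
      have "map Some (fill 0 L) @ l \<in> var_words (Suc k) (n' + n)"
        using word_append_var_words[OF Lw l] by simp
      moreover have "\<forall>a<Suc k. \<chi> (fill a (map Some (fill 0 L) @ l)) = \<gamma>"
        using that unfolding \<chi>0_def by (simp add: fill_append fill_map_Some)
      ultimately show ?thesis
        unfolding monochromatic_line_def by blast
    qed
    from n[OF \<chi>0] show ?thesis
    proof
      assume "monochromatic_line (Suc k) n \<chi>0"
      then show ?thesis
        using mono unfolding monochromatic_line_def by blast
    next
      assume "\<exists>Cs. card Cs = m \<and> focused_lines k n c \<chi>0 Cs"
      then obtain Cs f where Cs: "card Cs = m" "Cs \<subseteq> {..<c}" and f: "f \<in> words (Suc k) n"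
        and lines: "\<And>\<gamma>. \<gamma> \<in> Cs \<Longrightarrow> \<exists>l \<in> var_words (Suc k) n.
          fill k l = f \<and> (\<forall>a<k. \<chi>0 (fill a l) = \<gamma>)"
        unfolding focused_lines_def by blast
      show ?thesis
      \<comment> \<open>Either the focus has the colour of one of the lines, which makes that line
        monochromatic over all \<open>Suc k\<close> letters, or it brings in a new colour.\<close>
      proof (cases "\<chi>0 f \<in> Cs")
        case True
        then obtain l where "l \<in> var_words (Suc k) n" "fill k l = f"
          "\<forall>a<k. \<chi>0 (fill a l) = \<chi>0 f"
          using lines by blast
        then have "\<forall>a<Suc k. \<chi>0 (fill a l) = \<chi>0 f"
          by (metis less_Suc_eq)
        then show ?thesis
          using mono \<open>l \<in> _\<close> by blast
      next
        case False
        \<comment> \<open>The new colour belongs to \<open>L\<close> followed by the constant word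
          \<open>f\<close>, each old one to \<open>L\<close> followed by its old line, with one
          variable throughout. All of these are focused at \<open>fill k L @ f\<close>.\<close>
        have "\<exists>l \<in> var_words (Suc k) (n' + n).
            fill k l = fill k L @ f \<and> (\<forall>a<k. \<chi> (fill a l) = \<gamma>)" if \<gamma>: "\<gamma> \<in> insert (\<chi>0 f) Cs" for \<gamma>
        proof (cases "\<gamma> = \<chi>0 f")
          case True
          show ?thesis
          proof (rule bexI[OF _ var_words_append_word[OF LS f]])
            show "fill k (L @ map Some f) = fill k L @ f \<and> (\<forall>a<k. \<chi> (fill a (L @ map Some f)) = \<gamma>)"
              using same[OF _ f[folded W_def]] True
              by (metis fill_append fill_map_Some \<chi>0_def)
          qed
        next
          case False
          then obtain l where l: "l \<in> var_words (Suc k) n" "fill k l = f"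
            "\<forall>a<k. \<chi>0 (fill a l) = \<gamma>"
            using lines \<gamma> by blast
          show ?thesis
          proof (rule bexI[OF _ var_words_append[OF LS l(1)]])
            show "fill k (L @ l) = fill k L @ f \<and> (\<forall>a<k. \<chi> (fill a (L @ l)) = \<gamma>)"
              using same l fill_in_words[OF l(1)]
              by (metis W_def fill_append \<chi>0_def less_SucI)
          qed
        qed
        moreover have "insert (\<chi>0 f) Cs \<subseteq> {..<c}"
          using Cs \<chi>0 f by auto
        moreover have "card (insert (\<chi>0 f) Cs) = Suc m"
          using Cs False by (meson card_insert_disjoint finite_lessThan finite_subset)
        moreover have "fill k L @ f \<in> words (Suc k) (n' + n)"
          using words_append[OF Lw f] by simp
        ultimately show ?thesis
          unfolding focused_lines_def by blast
      qed
    qed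
  qed
  then show ?case
    by blast
qed

text \<open>Induction on the alphabet. Over one letter the line \<open>[None]\<close> has a single
  filling. In the step, \<open>Suc c\<close> focused colours are requested while only
  \<open>c\<close> exist, so the other alternative of \<open>colour_focusing\<close> must
  hold.\<close>

theorem hales_jewett_ex: "\<exists>n. hales_jewett (Suc k) c n"
proof (induction k arbitrary: c)
  case 0
  have "[None] \<in> var_words (Suc 0) 1"
    by (auto simp: var_words_def)
  then have "hales_jewett (Suc 0) c 1"
    unfolding hales_jewett_def monochromatic_line_def by blast
  then show ?case
    by blast
next
  case (Suc k)
  obtain n where n: "\<And>\<chi>. (\<forall>w \<in> words (Suc (Suc k)) n. \<chi> w < c) \<Longrightarrow>
      monochromatic_line (Suc (Suc k)) n \<chi> \<or>
      (\<exists>Cs. card Cs = Suc c \<and> focused_lines (Suc k) n c \<chi> Cs)"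
    using colour_focusing[OF _ Suc.IH, of c "Suc c"] by auto
  have "\<not> focused_lines (Suc k) n c \<chi> Cs" if "card Cs = Suc c" for \<chi> Cs
    using that card_mono[of "{..<c}" Cs] unfolding focused_lines_def by auto
  then have "hales_jewett (Suc (Suc k)) c n"
    using n unfolding hales_jewett_def by blast
  then show ?case
    by blast
qed


section \<open>Combinatorially rich sets\<close>

text \<open>Blocks may interleave, as the residue classes in \<open>rich_words\<close> do. The
  common bound \<open>r\<close> is what later keeps unions of blocks inside \<open>{..<r}\<close>,
  as \<open>rich_within\<close> demands.\<close>

definition disjoint_blocks :: "nat \<Rightarrow> nat \<Rightarrow> (nat \<Rightarrow> nat set) \<Rightarrow> bool" where
  "disjoint_blocks n r V \<longleftrightarrow> (\<forall>s<n. V s \<noteq> {} \<and> V s \<subseteq> {..<r}) \<and>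
     (\<forall>s<n. \<forall>s'<n. s \<noteq> s' \<longrightarrow> V s \<inter> V s' = {})"

lemma disjoint_blocks_finite: "disjoint_blocks n r V \<Longrightarrow> s < n \<Longrightarrow> finite (V s)"
  unfolding disjoint_blocks_def by (meson finite_lessThan finite_subset)

lemma Union_blocks:
  assumes V: "disjoint_blocks n r V" and U: "U \<subseteq> {..<n}" "U \<noteq> {}"
  shows "(\<Union>s \<in> U. V s) \<subseteq> {..<r}" "(\<Union>s \<in> U. V s) \<noteq> {}" "finite (\<Union>s \<in> U. V s)"
proof -
  show "(\<Union>s \<in> U. V s) \<subseteq> {..<r}" "(\<Union>s \<in> U. V s) \<noteq> {}"
    using V U unfolding disjoint_blocks_def by blast+
  then show "finite (\<Union>s \<in> U. V s)"
    using finite_lessThan by (meson finite_subset)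
qed

section \<open>Richness in a commutative semigroup\<close>

text \<open>One theory for both operations. The semigroup is a subset \<open>D\<close> of a monoid:
  the positive integers have no additive neutral element, but the big operator \<open>F\<close>
  requires one.\<close>

locale carried_comm_monoid = comm_monoid_set +
  fixes D :: "'a set"
  assumes carrier_closed: "x \<in> D \<Longrightarrow> y \<in> D \<Longrightarrow> x \<^bold>* y \<in> D"
    and carrier_nonempty: "D \<noteq> {}"
begin

lemma F_in_carrier:
  assumes "finite I" "I \<noteq> {}" "\<And>i. i \<in> I \<Longrightarrow> g i \<in> D"
  shows "F g I \<in> D"
  using assms by (induction I rule: finite_ne_induct) (auto simp: carrier_closed)

lemma op_F_in_carrier:
  assumes "finite I" "a \<in> D" "\<And>i. i \<in> I \<Longrightarrow> g i \<in> D"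
  shows "a \<^bold>* F g I \<in> D"
  using assms carrier_closed F_in_carrier[of I g] by (cases "I = {}") auto

text \<open>The order of the quantifiers matters: \<open>r\<close> is fixed before the sequences, so
  that in \<open>rich_Un\<close> the sequences witnessing failure can be chosen for an
  \<open>r\<close> that is already known.\<close>

definition rich_within :: "'a set \<Rightarrow> nat \<Rightarrow> nat \<Rightarrow> bool" where
  "rich_within A k r \<longleftrightarrow> (\<forall>g :: nat \<Rightarrow> nat \<Rightarrow> 'a. (\<forall>i<k. \<forall>t. g i t \<in> D) \<longrightarrow>
     (\<exists>a \<in> D. \<exists>H \<subseteq> {..<r}. H \<noteq> {} \<and> (\<forall>i<k. a \<^bold>* F (g i) H \<in> A)))"

definition rich :: "'a set \<Rightarrow> bool" where
  "rich A \<longleftrightarrow> (\<forall>k. \<exists>r. rich_within A k r)"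

lemma rich_withinD:
  assumes "rich_within A k r" and "\<forall>i<k. \<forall>t. g i t \<in> D"
  shows "\<exists>a \<in> D. \<exists>H \<subseteq> {..<r}. H \<noteq> {} \<and> (\<forall>i<k. a \<^bold>* F (g i) H \<in> A)"
  using assms unfolding rich_within_def by simp

lemma rich_within_mono:
  assumes r: "rich_within A k r" and AB: "A \<subseteq> B"
  shows "rich_within B k r"
  unfolding rich_within_def
proof (intro allI impI)
  fix g :: "nat \<Rightarrow> nat \<Rightarrow> 'a"
  assume "\<forall>i<k. \<forall>t. g i t \<in> D"
  from rich_withinD[OF r this] show "\<exists>a \<in> D. \<exists>H \<subseteq> {..<r}. H \<noteq> {} \<and> (\<forall>i<k. a \<^bold>* F (g i) H \<in> B)"
    using AB by blast
qed

lemma rich_mono: "rich A \<Longrightarrow> A \<subseteq> B \<Longrightarrow> rich B"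
  unfolding rich_def using rich_within_mono by blast

lemma rich_Int_carrier:
  assumes "rich A"
  shows "rich (A \<inter> D)"
proof -
  have "rich_within (A \<inter> D) k r" if r: "rich_within A k r" for k r
    unfolding rich_within_def
  proof (intro allI impI)
    fix g :: "nat \<Rightarrow> nat \<Rightarrow> 'a"
    assume g: "\<forall>i<k. \<forall>t. g i t \<in> D"
    from rich_withinD[OF r g] obtain a H where a: "a \<in> D" "H \<subseteq> {..<r}" "H \<noteq> {}" and
      A: "\<forall>i<k. a \<^bold>* F (g i) H \<in> A"
      by blast
    have "finite H"
      using a(2) by (rule finite_subset) simp
    then have "a \<^bold>* F (g i) H \<in> D" if "i < k" for i
      using g a that by (intro op_F_in_carrier) auto
    then show "\<exists>a \<in> D. \<exists>H \<subseteq> {..<r}. H \<noteq> {} \<and> (\<forall>i<k. a \<^bold>* F (g i) H \<in> A \<inter> D)"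
      using a A by blast
  qed
  then show ?thesis
    using assms unfolding rich_def by blast
qed

lemma not_rich_empty: "\<not> rich {}"
proof
  assume "rich {}"
  \<comment> \<open>One sequence is taken, since for \<open>k = 0\<close> no value would have to lie
    in the set.\<close>
  then obtain r where r: "rich_within {} 1 r"
    unfolding rich_def by blast
  obtain d where "d \<in> D"
    using carrier_nonempty by blast
  then show False
    using rich_withinD[OF r, of "\<lambda>_ _. d"] by auto
qed

text \<open>Reindexing along a bijection; in \<open>rich_words\<close> the sequences are indexed by
  words.\<close>

lemma rich_family:
  fixes I :: "'i set"
  assumes "rich A" and "finite I"
  shows "\<exists>r. \<forall>g :: 'i \<Rightarrow> nat \<Rightarrow> 'a. (\<forall>i \<in> I. \<forall>t. g i t \<in> D) \<longrightarrow>
     (\<exists>a \<in> D. \<exists>H \<subseteq> {..<r}. H \<noteq> {} \<and> (\<forall>i \<in> I. a \<^bold>* F (g i) H \<in> A))"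
proof -
  obtain h where "bij_betw h {0..<card I} I"
    using ex_bij_betw_nat_finite[OF assms(2)] by blast
  then have hI: "h ` {..<card I} = I"
    by (simp add: bij_betw_def lessThan_atLeast0)
  obtain r where r: "rich_within A (card I) r"
    using assms unfolding rich_def by blast
  show ?thesis
  proof (intro exI[of _ r] allI impI)
    fix g :: "'i \<Rightarrow> nat \<Rightarrow> 'a"
    assume "\<forall>i \<in> I. \<forall>t. g i t \<in> D"
    then have gh: "\<forall>i<card I. \<forall>t. (\<lambda>i. g (h i)) i t \<in> D"
      using hI by auto
    have conv: "(\<forall>i<card I. a \<^bold>* F (g (h i)) H \<in> A) \<longleftrightarrow> (\<forall>i \<in> I. a \<^bold>* F (g i) H \<in> A)" for a H
      using hI by (metis imageE imageI lessThan_iff)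
    show "\<exists>a \<in> D. \<exists>H \<subseteq> {..<r}. H \<noteq> {} \<and> (\<forall>i \<in> I. a \<^bold>* F (g i) H \<in> A)"
      using rich_withinD[OF r gh] unfolding conv .
  qed
qed

text \<open>By associativity the factor \<open>d\<close> is absorbed into the translate
  \<open>a\<close>. The contrapositive yields the shift invariance of
  \<open>rich_filter\<close>.\<close>

lemma rich_translate:
  assumes "rich {x. d \<^bold>* x \<in> A}" and d: "d \<in> D"
  shows "rich A"
proof -
  have "rich_within A k r" if r: "rich_within {x. d \<^bold>* x \<in> A} k r" for k r
    unfolding rich_within_def
  proof (intro allI impI)
    fix g :: "nat \<Rightarrow> nat \<Rightarrow> 'a"
    assume g: "\<forall>i<k. \<forall>t. g i t \<in> D"
    from rich_withinD[OF r g] obtain a H where "a \<in> D" "H \<subseteq> {..<r}" "H \<noteq> {}"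
      "\<forall>i<k. a \<^bold>* F (g i) H \<in> {x. d \<^bold>* x \<in> A}"
      by blast
    then show "\<exists>a \<in> D. \<exists>H \<subseteq> {..<r}. H \<noteq> {} \<and> (\<forall>i<k. a \<^bold>* F (g i) H \<in> A)"
      using d carrier_closed by (intro bexI[of _ "d \<^bold>* a"] exI[of _ H]) (auto simp: assoc)
  qed
  then show ?thesis
    using assms(1) unfolding rich_def by blast
qed

lemma F_Union_blocks:
  assumes V: "disjoint_blocks n r V" and U: "U \<subseteq> {..<n}"
  shows "F g (\<Union>s \<in> U. V s) = F (\<lambda>s. F g (V s)) U"
proof (rule UNION_disjoint)
  show "finite U"
    using U by (rule finite_subset) simp
  show "\<forall>s \<in> U. finite (V s)"
    using disjoint_blocks_finite[OF V] U by blast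
  show "\<forall>s \<in> U. \<forall>s' \<in> U. s \<noteq> s' \<longrightarrow> V s \<inter> V s' = {}"
    using V U unfolding disjoint_blocks_def by (meson lessThan_iff subsetD)
qed

text \<open>Cut the index set into intervals of length \<open>n\<close>.  A word \<open>w\<close> of length \<open>n\<close> prescribes which
  sequence is used at each place of an interval, and richness is applied to the sequences of
  interval sums indexed by the words.\<close>

lemma rich_words:
  assumes A: "rich A" and n: "n > 0"
  shows "\<exists>r. \<forall>g :: nat \<Rightarrow> nat \<Rightarrow> 'a. (\<forall>i<k. \<forall>t. g i t \<in> D) \<longrightarrow>
     (\<exists>a \<in> D. \<exists>V. disjoint_blocks n r V \<and>
       (\<forall>w \<in> words k n. a \<^bold>* F (\<lambda>s. F (g (w ! s)) (V s)) {..<n} \<in> A))"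
proof -
  obtain r where r: "\<forall>g :: nat list \<Rightarrow> nat \<Rightarrow> 'a. (\<forall>w \<in> words k n. \<forall>t. g w t \<in> D) \<longrightarrow>
     (\<exists>a \<in> D. \<exists>H \<subseteq> {..<r}. H \<noteq> {} \<and> (\<forall>w \<in> words k n. a \<^bold>* F (g w) H \<in> A))"
    using rich_family[OF A finite_words] ..
  show ?thesis
  \<comment> \<open>There are \<open>r\<close> intervals of length \<open>n\<close>; the
    \<open>j\<close>-th one starts at \<open>j * n\<close>.\<close>
  proof (intro exI[of _ "r * n"] allI impI)
    fix g :: "nat \<Rightarrow> nat \<Rightarrow> 'a"
    assume g: "\<forall>i<k. \<forall>t. g i t \<in> D"
    have gw: "F (\<lambda>s. g (w ! s) (j * n + s)) {..<n} \<in> D" if "w \<in> words k n" for w j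
    proof (rule F_in_carrier)
      fix s assume "s \<in> {..<n}"
      then have "w ! s \<in> set w" and "set w \<subseteq> {..<k}"
        using that by (simp_all add: words_def)
      then show "g (w ! s) (j * n + s) \<in> D"
        using g by blast
    qed (use n in auto)
    from r[THEN spec, of "\<lambda>w j. F (\<lambda>s. g (w ! s) (j * n + s)) {..<n}"] gw
    obtain a H where a: "a \<in> D" and H: "H \<subseteq> {..<r}" "H \<noteq> {}" and
      aH: "\<forall>w \<in> words k n. a \<^bold>* F (\<lambda>j. F (\<lambda>s. g (w ! s) (j * n + s)) {..<n}) H \<in> A"
      by blast
    \<comment> \<open>The block \<open>V s\<close> collects the \<open>s\<close>-th places of the
      selected intervals. Exchanging the two summations turns sums over intervals into sums over
      blocks.\<close>
    define V where "V s = (\<lambda>j. j * n + s) ` H" for s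
    have in_range: "j * n + s < r * n" if "j < r" "s < n" for j s
    proof -
      have "j * n + s < Suc j * n"
        using that by simp
      also have "\<dots> \<le> r * n"
        using that by (intro mult_le_mono1) simp
      finally show ?thesis .
    qed
    have "V s \<noteq> {} \<and> V s \<subseteq> {..<r * n}" if "s < n" for s
      using H in_range that by (auto simp: V_def)
    moreover have "V s \<inter> V s' = {}" if "s < n" "s' < n" "s \<noteq> s'" for s s'
    proof -
      have "(j * n + s) mod n = s" "(j * n + s') mod n = s'" for j
        using that by simp_all
      then have "j * n + s \<noteq> i * n + s'" for i j
        using that(3) by metis
      then show ?thesis
        by (auto simp: V_def)
    qed
    ultimately have V: "disjoint_blocks n (r * n) V"
      unfolding disjoint_blocks_def by simp
    have "a \<^bold>* F (\<lambda>s. F (g (w ! s)) (V s)) {..<n} \<in> A" if "w \<in> words k n" for w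
    proof -
      have "F (g (w ! s)) (V s) = F (\<lambda>j. g (w ! s) (j * n + s)) H" for s
        unfolding V_def using n by (subst reindex) (auto simp: inj_on_def comp_def)
      then show ?thesis
        using aH that by (simp add: swap[of _ H])
    qed
    then show "\<exists>a \<in> D. \<exists>V. disjoint_blocks n (r * n) V \<and>
       (\<forall>w \<in> words k n. a \<^bold>* F (\<lambda>s. F (g (w ! s)) (V s)) {..<n} \<in> A)"
      using V by (intro bexI[OF _ a] exI[of _ V]) simp
  qed
qed

text \<open>On a combinatorial line the blocks outside \<open>U\<close> carry fixed letters and
  merge with \<open>a\<close> into \<open>b\<close>, while the blocks in \<open>U\<close> carry the
  variable and unite into one index set. The same \<open>b\<close> serves all points of the
  line.\<close>

lemma collapse_line:
  assumes a: "a \<in> D" and g: "\<forall>i<k. \<forall>t. g i t \<in> D" and V: "disjoint_blocks n r V"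
    and w0: "\<forall>s<n. w0 s < k" and U: "U \<subseteq> {..<n}"
  shows "\<exists>b \<in> D. \<forall>w i. (\<forall>s<n. w ! s = (if s \<in> U then i else w0 s)) \<longrightarrow>
    a \<^bold>* F (\<lambda>s. F (g (w ! s)) (V s)) {..<n} = b \<^bold>* F (g i) (\<Union>s \<in> U. V s)"
proof (intro bexI allI impI)
  let ?b = "a \<^bold>* F (\<lambda>s. F (g (w0 s)) (V s)) ({..<n} - U)"
  have "F (g (w0 s)) (V s) \<in> D" if "s < n" for s
    using V that g w0 disjoint_blocks_finite[OF V that]
    by (intro F_in_carrier) (auto simp: disjoint_blocks_def)
  then show "?b \<in> D"
    using a by (intro op_F_in_carrier) auto
  fix w i
  assume w: "\<forall>s<n. w ! s = (if s \<in> U then i else w0 s)"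
  have "F (\<lambda>s. F (g (w ! s)) (V s)) {..<n} =
      F (\<lambda>s. F (g (w ! s)) (V s)) ({..<n} - U) \<^bold>* F (\<lambda>s. F (g (w ! s)) (V s)) U"
    using subset_diff[OF U] by simp
  also have "F (\<lambda>s. F (g (w ! s)) (V s)) ({..<n} - U) =
      F (\<lambda>s. F (g (w0 s)) (V s)) ({..<n} - U)"
    by (rule cong) (auto simp: w)
  also have "F (\<lambda>s. F (g (w ! s)) (V s)) U = F (\<lambda>s. F (g i) (V s)) U"
    using U by (intro cong) (auto simp: w)
  also have "\<dots> = F (g i) (\<Union>s \<in> U. V s)"
    by (rule F_Union_blocks[OF V U, symmetric])
  finally show "a \<^bold>* F (\<lambda>s. F (g (w ! s)) (V s)) {..<n} = ?b \<^bold>* F (g i) (\<Union>s \<in> U. V s)"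
    by (simp add: assoc)
qed

section \<open>Partition regularity of richness\<close>

text \<open>If \<open>A\<close> fails for \<open>k\<close> sequences and \<open>B\<close> for
  \<open>l\<close>, both bad families are used together as letters. The word values lie in
  \<open>A \<union> B\<close>; a line monochromatic for membership in \<open>A\<close> collapses to
  one translate and one \<open>H\<close> that are good for the whole family of \<open>A\<close> or
  for the whole family of \<open>B\<close>.\<close>

theorem rich_Un:
  assumes "rich (A \<union> B)"
  shows "rich A \<or> rich B"
proof (rule ccontr)
  assume "\<not> (rich A \<or> rich B)"
  then obtain k l where k: "\<And>r. \<not> rich_within A k r" and l: "\<And>r. \<not> rich_within B l r"
    unfolding rich_def by blast
  \<comment> \<open>The extra letter, standing for a constant sequence, keeps the alphabet
    nonempty.\<close>
  define K where "K = Suc (k + l)"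
  obtain n where n: "hales_jewett K 2 n"
    using hales_jewett_ex K_def by blast
  have "monochromatic_line K n (\<lambda>_. 0)"
    using n unfolding hales_jewett_def by simp
  then have n0: "n > 0"
    unfolding monochromatic_line_def var_words_def by auto
  obtain r where r: "\<forall>g :: nat \<Rightarrow> nat \<Rightarrow> 'a. (\<forall>i<K. \<forall>t. g i t \<in> D) \<longrightarrow>
     (\<exists>a \<in> D. \<exists>V. disjoint_blocks n r V \<and>
       (\<forall>w \<in> words K n. a \<^bold>* F (\<lambda>s. F (g (w ! s)) (V s)) {..<n} \<in> A \<union> B))"
    using rich_words[OF assms n0] ..
  obtain gA where gA: "\<forall>i<k. \<forall>t. gA i t \<in> D" and
    noA: "\<not> (\<exists>a \<in> D. \<exists>H \<subseteq> {..<r}. H \<noteq> {} \<and> (\<forall>i<k. a \<^bold>* F (gA i) H \<in> A))"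
    using k[of r] unfolding rich_within_def not_all not_imp by (elim exE conjE) (rule that)
  obtain gB where gB: "\<forall>i<l. \<forall>t. gB i t \<in> D" and
    noB: "\<not> (\<exists>a \<in> D. \<exists>H \<subseteq> {..<r}. H \<noteq> {} \<and> (\<forall>i<l. a \<^bold>* F (gB i) H \<in> B))"
    using l[of r] unfolding rich_within_def not_all not_imp by (elim exE conjE) (rule that)
  obtain d where d: "d \<in> D"
    using carrier_nonempty by blast
  define g where "g i = (if i < k then gA i else if i < k + l then gB (i - k) else (\<lambda>_. d))" for i
  have g: "\<forall>i<K. \<forall>t. g i t \<in> D"
    using gA gB d by (simp add: g_def)
  obtain a V where a: "a \<in> D" and V: "disjoint_blocks n r V" and
    AB: "\<forall>w \<in> words K n. a \<^bold>* F (\<lambda>s. F (g (w ! s)) (V s)) {..<n} \<in> A \<union> B"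
    using r[THEN spec, of g] g by blast
  define \<chi> :: "nat list \<Rightarrow> nat" where
    "\<chi> w = (if a \<^bold>* F (\<lambda>s. F (g (w ! s)) (V s)) {..<n} \<in> A then 0 else 1)" for w
  have "monochromatic_line K n \<chi>"
    using n unfolding hales_jewett_def \<chi>_def by simp
  then obtain L \<gamma> where L: "L \<in> var_words K n" and \<gamma>: "\<And>i. i < K \<Longrightarrow> \<chi> (fill i L) = \<gamma>"
    unfolding monochromatic_line_def by blast
  have len: "length L = n"
    using L by (simp add: var_words_def)
  define U where "U = {s. s < n \<and> L ! s = None}"
  have U: "U \<subseteq> {..<n}" "U \<noteq> {}"
    using L by (auto simp: U_def var_words_def in_set_conv_nth)
  define w0 where "w0 s = the (L ! s)" for s
  \<comment> \<open>At variable positions \<open>w0\<close> is \<open>the None\<close>, which need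
    not be a letter; \<open>0\<close> is put there instead.\<close>
  define w0' where "w0' s = (if s \<in> U then 0 else w0 s)" for s
  have w0: "w0' s < K" if "s < n" for s
  proof (cases "s \<in> U")
    case False
    with \<open>s < n\<close> obtain c where "L ! s = Some c"
      by (auto simp: U_def)
    moreover have "L ! s \<in> set L" "set L \<subseteq> insert None (Some ` {..<K})"
      using L that len by (simp_all add: var_words_def)
    ultimately show ?thesis
      using False by (auto simp: w0'_def w0_def)
  qed (simp add: w0'_def K_def)
  obtain b where b: "b \<in> D" and
    bw: "\<forall>w i. (\<forall>s<n. w ! s = (if s \<in> U then i else w0' s)) \<longrightarrow>
      a \<^bold>* F (\<lambda>s. F (g (w ! s)) (V s)) {..<n} = b \<^bold>* F (g i) (\<Union>s \<in> U. V s)"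
    using collapse_line[OF a g V _ U(1), of w0'] w0 by blast
  define H where "H = (\<Union>s \<in> U. V s)"
  have fill: "fill i L ! s = (if s \<in> U then i else w0' s)" if "s < n" for i s
    using that by (auto simp: fill_def len U_def w0'_def w0_def split: option.splits)
  have val: "a \<^bold>* F (\<lambda>s. F (g (fill i L ! s)) (V s)) {..<n} = b \<^bold>* F (g i) H" for i
    unfolding H_def using bw fill by blast
  have col: "\<chi> (fill i L) = (if b \<^bold>* F (g i) H \<in> A then 0 else 1)" for i
    by (simp add: \<chi>_def val)
  have inAB: "b \<^bold>* F (g i) H \<in> A \<union> B" if "i < K" for i
    using AB fill_in_words[OF L that] by (auto simp: val[symmetric])
  have H: "H \<subseteq> {..<r}" "H \<noteq> {}"
    using Union_blocks[OF V U] unfolding H_def by simp_all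
  show False
  proof (cases "\<gamma> = 0")
    case True
    have "b \<^bold>* F (gA i) H \<in> A" if "i < k" for i
    proof -
      have "g i = gA i" "i < K"
        using that by (simp_all add: g_def K_def)
      then show ?thesis
        using col[of i] \<gamma>[of i] True by (metis one_neq_zero)
    qed
    then show False
      using noA b H by blast
  next
    case False
    have "b \<^bold>* F (gB i) H \<in> B" if "i < l" for i
    proof -
      have "g (k + i) = gB i" "k + i < K"
        using that by (simp_all add: g_def K_def)
      then show ?thesis
        using col[of "k + i"] \<gamma>[of "k + i"] inAB[of "k + i"] False by (metis Un_iff)
    qed
    then show False
      using noB b H by blast
  qed
qed

end

text \<open>Columns obtained from the richness of \<open>P\<close> are selected by the richness of \<open>Q\<close>; this makes
  one index set serve both operations.\<close>

lemma rich_rich: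
  fixes g :: "'i \<Rightarrow> nat \<Rightarrow> 'a"
  assumes "carried_comm_monoid f\<^sub>1 z\<^sub>1 D" "carried_comm_monoid f\<^sub>2 z\<^sub>2 D"
    and P: "carried_comm_monoid.rich f\<^sub>1 z\<^sub>1 D P" and Q: "carried_comm_monoid.rich f\<^sub>2 z\<^sub>2 D Q"
    and I: "finite I" and g: "\<And>i t. i \<in> I \<Longrightarrow> g i t \<in> D"
  obtains a b H where "a \<in> D" "b \<in> D" "finite H" "H \<noteq> {}"
    "\<And>i. i \<in> I \<Longrightarrow> f\<^sub>1 a (comm_monoid_set.F f\<^sub>1 z\<^sub>1 (g i) H) \<in> P"
    "\<And>i. i \<in> I \<Longrightarrow> f\<^sub>2 b (comm_monoid_set.F f\<^sub>2 z\<^sub>2 (g i) H) \<in> Q"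
proof -
  interpret one: carried_comm_monoid f\<^sub>1 z\<^sub>1 D
    by fact
  interpret two: carried_comm_monoid f\<^sub>2 z\<^sub>2 D
    by fact
  obtain d where d: "d \<in> D"
    using one.carrier_nonempty by blast
  define k where "k = Suc (card I)"
  obtain h where h: "bij_betw h {0..<card I} I"
    using ex_bij_betw_nat_finite[OF I] by blast
  define g' where "g' i = (if i < card I then g (h i) else (\<lambda>_. d))" for i
  have g': "\<forall>i<k. \<forall>t. g' i t \<in> D"
    using g d bij_betw_apply[OF h] by (simp add: g'_def)
  obtain r where r: "two.rich_within Q k r"
    using Q unfolding two.rich_def by blast
  have r0: "r > 0"
    using two.rich_withinD[OF r g'] by auto
  obtain r' where r': "\<forall>g :: nat \<Rightarrow> nat \<Rightarrow> 'a. (\<forall>i<k. \<forall>t. g i t \<in> D) \<longrightarrow>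
     (\<exists>a \<in> D. \<exists>V. disjoint_blocks r r' V \<and>
       (\<forall>w \<in> words k r. f\<^sub>1 a (one.F (\<lambda>s. one.F (g (w ! s)) (V s)) {..<r}) \<in> P))"
    using one.rich_words[OF P r0] ..
  obtain a V where a: "a \<in> D" and V: "disjoint_blocks r r' V" and
    aV: "\<forall>w \<in> words k r. f\<^sub>1 a (one.F (\<lambda>s. one.F (g' (w ! s)) (V s)) {..<r}) \<in> P"
    using r'[THEN spec, of g'] g' by blast
  \<comment> \<open>The blocks supplied by \<open>P\<close> become the indices for \<open>Q\<close>:
    their values under the second operation form new sequences, continued by \<open>d\<close> beyond
    the \<open>r\<close> blocks.\<close>
  have "two.F (g' i) (V s) \<in> D" if "s < r" "i < k" for i s
    using V that g' disjoint_blocks_finite[OF V that(1)]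
    by (intro two.F_in_carrier) (auto simp: disjoint_blocks_def)
  then have gd: "\<forall>i<k. \<forall>s. (\<lambda>i s. if s < r then two.F (g' i) (V s) else d) i s \<in> D"
    using d by simp
  obtain b U where b: "b \<in> D" and U: "U \<subseteq> {..<r}" "U \<noteq> {}" and
    bU: "\<forall>i<k. f\<^sub>2 b (two.F (\<lambda>s. if s < r then two.F (g' i) (V s) else d) U) \<in> Q"
    using two.rich_withinD[OF r gd] by blast
  define H where "H = (\<Union>s \<in> U. V s)"
  \<comment> \<open>Words equal to \<open>i\<close> on \<open>U\<close> and \<open>0\<close>
    elsewhere give, for \<open>P\<close>, values over the very \<open>H\<close> that
    \<open>Q\<close> has selected; the blocks outside \<open>U\<close> go into
    \<open>a'\<close>.\<close>
  obtain a' where a': "a' \<in> D" and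
    aw: "\<forall>w i. (\<forall>s<r. w ! s = (if s \<in> U then i else 0)) \<longrightarrow>
      f\<^sub>1 a (one.F (\<lambda>s. one.F (g' (w ! s)) (V s)) {..<r}) = f\<^sub>1 a' (one.F (g' i) H)"
    using one.collapse_line[OF a g' V _ U(1), of "\<lambda>_. 0"] unfolding H_def k_def by blast
  have inP: "f\<^sub>1 a' (one.F (g' i) H) \<in> P" if "i < k" for i
  proof -
    define w where "w = map (\<lambda>s. if s \<in> U then i else 0) [0..<r]"
    have "w \<in> words k r"
      using that by (auto simp: w_def words_def)
    moreover have "w ! s = (if s \<in> U then i else 0)" if "s < r" for s
      using that by (simp add: w_def)
    ultimately show ?thesis
      using aV aw by metis
  qed
  have inQ: "f\<^sub>2 b (two.F (g' i) H) \<in> Q" if "i < k" for i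
  proof -
    have "two.F (\<lambda>s. if s < r then two.F (g' i) (V s) else d) U = two.F (\<lambda>s. two.F (g' i) (V s)) U"
      using U by (intro two.cong) auto
    also have "\<dots> = two.F (g' i) H"
      unfolding H_def by (rule two.F_Union_blocks[OF V U(1), symmetric])
    finally show ?thesis
      using bU that by metis
  qed
  have idx: "\<exists>j<k. g' j = g i" if i: "i \<in> I" for i
  proof -
    obtain j where "j < card I" "h j = i"
      using h i unfolding bij_betw_def by force
    then show ?thesis
      unfolding g'_def k_def by (intro exI[of _ j]) simp
  qed
  have "finite H" "H \<noteq> {}"
    using Union_blocks[OF V U] by (simp_all add: H_def)
  then show thesis
    using that[OF a' b] idx inP inQ by metis
qed


section \<open>Idempotent ultrafilters\<close>

definition ultrafilter :: "'a filter \<Rightarrow> bool" where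
  "ultrafilter p \<longleftrightarrow> p \<noteq> bot \<and> (\<forall>P. eventually P p \<or> eventually (\<lambda>x. \<not> P x) p)"

lemma ultrafilter_neq_bot: "ultrafilter p \<Longrightarrow> p \<noteq> bot"
  by (simp add: ultrafilter_def)

lemma ultrafilter_not_iff:
  assumes "ultrafilter p"
  shows "\<not> eventually P p \<longleftrightarrow> eventually (\<lambda>x. \<not> P x) p"
proof
  assume "eventually (\<lambda>x. \<not> P x) p"
  then show "\<not> eventually P p"
    using assms eventually_False[of p] eventually_elim2[of P p "\<lambda>x. \<not> P x" "\<lambda>_. False"]
    unfolding ultrafilter_def by blast
qed (use assms in \<open>auto simp: ultrafilter_def\<close>)

text \<open>Zorn's lemma for decreasing filters, shared by the existence of ultrafilters and by
  Ellis' lemma. In a chain the infimum of two members is the smaller one, so what holds eventually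
  in \<open>Inf C\<close> does so in some member; that is the third premise available to a user of
  the lemma.\<close>

lemma minimal_filter_ex:
  assumes J: "Q J"
    and Inf: "\<And>C. C \<noteq> {} \<Longrightarrow> (\<And>F. F \<in> C \<Longrightarrow> Q F) \<Longrightarrow>
      (\<And>P. eventually P (Inf C) \<longleftrightarrow> (\<exists>F \<in> C. eventually P F)) \<Longrightarrow> Q (Inf C)"
  obtains F where "F \<le> J" "Q F" "\<And>G. Q G \<Longrightarrow> G \<le> F \<Longrightarrow> G = F"
proof -
  let ?A = "{F. F \<le> J \<and> Q F}"
  have "\<exists>F \<in> ?A. \<forall>G \<in> ?A. F \<ge> G \<longrightarrow> G = F"
  proof (rule predicate_Zorn)
    show "partial_order_on ?A (relation_of (\<ge>) ?A)"
      by (rule partial_order_on_relation_ofI) auto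
    fix C assume C: "C \<in> Chains (relation_of (\<ge>) ?A)"
    show "\<exists>U \<in> ?A. \<forall>F \<in> C. F \<ge> U"
    proof (cases "C = {}")
      case True
      then show ?thesis
        using J by auto
    next
      case False
      have sub: "C \<subseteq> ?A" and lin: "\<And>F G. F \<in> C \<Longrightarrow> G \<in> C \<Longrightarrow> F \<le> G \<or> G \<le> F"
        using C by (auto simp: Chains_def relation_of_def)
      have "eventually P (Inf C) \<longleftrightarrow> (\<exists>F \<in> C. eventually P F)" for P
        using lin by (intro eventually_Inf_base False) (metis inf.absorb1 inf.absorb2 order_refl)
      then have "Q (Inf C)"
        using Inf[OF False] sub by blast
      moreover have "Inf C \<le> J"
        using False sub by (auto intro: Inf_lower2)
      ultimately show ?thesis
        by (intro bexI[of _ "Inf C"]) (auto intro: Inf_lower)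
    qed
  qed
  then obtain F where "F \<le> J" "Q F" "\<And>G. G \<le> J \<Longrightarrow> Q G \<Longrightarrow> G \<le> F \<Longrightarrow> G = F"
    by blast
  then show thesis
    using that by (meson order_trans)
qed

text \<open>A minimal proper filter decides every \<open>P\<close>: restricting it to
  \<open>P\<close> gives either the improper filter or, by minimality, the same filter.\<close>

lemma ultrafilter_le_ex:
  assumes "F \<noteq> bot"
  obtains p where "ultrafilter p" "p \<le> F"
proof -
  obtain p where p: "p \<le> F" "p \<noteq> bot" and min: "\<And>G. G \<noteq> bot \<Longrightarrow> G \<le> p \<Longrightarrow> G = p"
  proof (rule minimal_filter_ex[of "\<lambda>F. F \<noteq> bot" F])
    fix C :: "'a filter set"
    assume "\<And>F. F \<in> C \<Longrightarrow> F \<noteq> bot"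
      and "\<And>P. eventually P (Inf C) \<longleftrightarrow> (\<exists>F \<in> C. eventually P F)"
    then show "Inf C \<noteq> bot"
      by (metis eventually_False)
  qed (use assms in auto)
  have "eventually P p \<or> eventually (\<lambda>x. \<not> P x) p" for P
  proof (cases "inf p (principal {x. P x}) = bot")
    case True
    then have "eventually (\<lambda>_. False) (inf p (principal {x. P x}))"
      by simp
    then show ?thesis
      by (simp add: eventually_inf_principal)
  next
    case False
    then have "inf p (principal {x. P x}) = p"
      by (rule min) simp
    moreover have "eventually P (inf p (principal {x. P x}))"
      by (simp add: eventually_inf_principal)
    ultimately show ?thesis
      by simp
  qed
  then show thesis
    using that p unfolding ultrafilter_def by blast
qed

section \<open>Products of filters and idempotents\<close>

text \<open>On ultrafilters this is the usual extension of \<open>f\<close> to the Stone-Cech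
  compactification. Defining it for all filters lets \<open>star f F F \<le> F\<close> express that
  the closed set of ultrafilters below \<open>F\<close> contains their products.\<close>

definition star :: "('a \<Rightarrow> 'a \<Rightarrow> 'a) \<Rightarrow> 'a filter \<Rightarrow> 'a filter \<Rightarrow> 'a filter" where
  "star f F G = Abs_filter (\<lambda>P. eventually (\<lambda>x. eventually (\<lambda>y. P (f x y)) G) F)"

lemma eventually_star:
  "eventually P (star f F G) \<longleftrightarrow> eventually (\<lambda>x. eventually (\<lambda>y. P (f x y)) G) F"
  unfolding star_def
proof (rule eventually_Abs_filter, rule is_filter.intro)
  fix P Q
  show "eventually (\<lambda>x. eventually (\<lambda>y. P (f x y)) G) F \<Longrightarrow>
      eventually (\<lambda>x. eventually (\<lambda>y. Q (f x y)) G) F \<Longrightarrow>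
      eventually (\<lambda>x. eventually (\<lambda>y. P (f x y) \<and> Q (f x y)) G) F"
    by (simp add: eventually_conj_iff)
  show "\<forall>x. P x \<longrightarrow> Q x \<Longrightarrow> eventually (\<lambda>x. eventually (\<lambda>y. P (f x y)) G) F \<Longrightarrow>
      eventually (\<lambda>x. eventually (\<lambda>y. Q (f x y)) G) F"
    by (auto elim!: eventually_mono)
qed simp

lemma star_mono: "F \<le> F' \<Longrightarrow> G \<le> G' \<Longrightarrow> star f F G \<le> star f F' G'"
proof (rule filter_leI)
  fix P
  assume FG: "F \<le> F'" "G \<le> G'" and "eventually P (star f F' G')"
  then have "eventually (\<lambda>x. eventually (\<lambda>y. P (f x y)) G') F"
    using filter_leD by (simp add: eventually_star) blast
  then show "eventually P (star f F G)"
    unfolding eventually_star by (rule eventually_mono) (rule filter_leD[OF FG(2)])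
qed

lemma star_assoc:
  assumes "\<And>x y z. f (f x y) z = f x (f y z)"
  shows "star f (star f F G) H = star f F (star f G H)"
  by (simp add: filter_eq_iff eventually_star assms)

lemma star_neq_bot: "F \<noteq> bot \<Longrightarrow> G \<noteq> bot \<Longrightarrow> star f F G \<noteq> bot"
  by (simp add: trivial_limit_def eventually_star)

text \<open>Ellis' lemma, with filters in place of closed subsemigroups: a minimal nontrivial filter
  \<open>F\<close> with \<open>F * F \<le> F\<close> is an ultrafilter.  For an ultrafilter \<open>p \<le> F\<close>, minimality gives first
  \<open>F * p = F\<close>, then \<open>F * p \<le> p\<close>.\<close>

theorem idempotent_ultrafilter_ex:
  assumes assoc: "\<And>x y z. f (f x y) z = f x (f y z)"
    and J: "J \<noteq> bot" "star f J J \<le> J"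
  obtains p where "ultrafilter p" "p \<le> J" "star f p p = p"
proof -
  obtain F where F: "F \<le> J" "F \<noteq> bot" "star f F F \<le> F"
    and min: "\<And>G. G \<noteq> bot \<and> star f G G \<le> G \<Longrightarrow> G \<le> F \<Longrightarrow> G = F"
  proof (rule minimal_filter_ex[of "\<lambda>F. F \<noteq> bot \<and> star f F F \<le> F" J])
    fix C :: "'a filter set"
    assume C: "C \<noteq> {}" "\<And>F. F \<in> C \<Longrightarrow> F \<noteq> bot \<and> star f F F \<le> F"
      and Inf: "\<And>P. eventually P (Inf C) \<longleftrightarrow> (\<exists>F \<in> C. eventually P F)"
    have "Inf C \<noteq> bot"
      using C Inf by (metis eventually_False)
    moreover have "star f (Inf C) (Inf C) \<le> Inf C"
    proof (rule filter_leI)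
      fix P assume "eventually P (Inf C)"
      then obtain F where "F \<in> C" "eventually P F"
        using Inf by blast
      then have "eventually P (star f F F)"
        using C filter_leD by blast
      moreover have "star f (Inf C) (Inf C) \<le> star f F F"
        using \<open>F \<in> C\<close> by (intro star_mono Inf_lower)
      ultimately show "eventually P (star f (Inf C) (Inf C))"
        using filter_leD by blast
    qed
    ultimately show "Inf C \<noteq> bot \<and> star f (Inf C) (Inf C) \<le> Inf C" ..
  qed (use J in auto)
  have FF: "star f F F = F"
    using F by (intro min conjI star_neq_bot star_mono)
  obtain p where p: "ultrafilter p" "p \<le> F"
    using ultrafilter_le_ex F by blast
  have "p \<noteq> bot"
    using p by (simp add: ultrafilter_def)
  have Fp: "star f F p = F"
  proof (rule min)
    have "star f (star f F p) (star f F p) = star f (star f F (star f p F)) p"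
      by (simp add: star_assoc assoc)
    also have "\<dots> \<le> star f (star f F (star f F F)) p"
      using p by (intro star_mono order_refl)
    also have "\<dots> = star f F p"
      by (simp add: FF)
    finally show "star f F p \<noteq> bot \<and> star f (star f F p) (star f F p) \<le> star f F p"
      using F \<open>p \<noteq> bot\<close> star_neq_bot by blast
    show "star f F p \<le> F"
      using star_mono[OF order_refl p(2), of f F] FF by simp
  qed
  \<comment> \<open>\<open>R A x\<close> says that \<open>A\<close> belongs to the translate of
    \<open>p\<close> by \<open>x\<close>. The filter \<open>G\<close> adds to \<open>F\<close> all
    sets \<open>{x. R A x}\<close> with \<open>A\<close> in \<open>p\<close>; it encodes the closed
    subsemigroup of those elements whose product with \<open>p\<close> is \<open>p\<close>.\<close>
  define R where "R A x \<longleftrightarrow> eventually (\<lambda>y. A (f x y)) p" for A x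
  define G where "G = Abs_filter (\<lambda>P. \<exists>A. eventually A p \<and> eventually (\<lambda>x. R A x \<longrightarrow> P x) F)"
  have G: "eventually P G \<longleftrightarrow> (\<exists>A. eventually A p \<and> eventually (\<lambda>x. R A x \<longrightarrow> P x) F)" for P
    unfolding G_def
  proof (rule eventually_Abs_filter, rule is_filter.intro)
    show "\<exists>A. eventually A p \<and> eventually (\<lambda>x. R A x \<longrightarrow> True) F"
      by (intro exI[of _ "\<lambda>_. True"]) simp
    fix P Q
    assume "\<exists>A. eventually A p \<and> eventually (\<lambda>x. R A x \<longrightarrow> P x) F"
      and "\<exists>A. eventually A p \<and> eventually (\<lambda>x. R A x \<longrightarrow> Q x) F"
    then obtain A B where "eventually A p" "eventually (\<lambda>x. R A x \<longrightarrow> P x) F"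
      "eventually B p" "eventually (\<lambda>x. R B x \<longrightarrow> Q x) F"
      by blast
    then show "\<exists>A. eventually A p \<and> eventually (\<lambda>x. R A x \<longrightarrow> P x \<and> Q x) F"
      by (intro exI[of _ "\<lambda>x. A x \<and> B x"])
        (auto simp: R_def eventually_conj_iff elim: eventually_elim2)
  next
    fix P Q
    assume "\<forall>x. P x \<longrightarrow> Q x" "\<exists>A. eventually A p \<and> eventually (\<lambda>x. R A x \<longrightarrow> P x) F"
    then show "\<exists>A. eventually A p \<and> eventually (\<lambda>x. R A x \<longrightarrow> Q x) F"
      by (auto elim!: eventually_mono)
  qed
  have "G = F"
  proof (rule min)
    \<comment> \<open>Otherwise the complement of some \<open>A\<close> in \<open>p\<close> would
      lie in \<open>star f F p\<close>, which is \<open>F\<close>, and hence in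
      \<open>p\<close>.\<close>
    have "\<not> eventually (\<lambda>_. False) G"
    proof
      assume "eventually (\<lambda>_. False) G"
      then obtain A where A: "eventually A p" "eventually (\<lambda>x. \<not> R A x) F"
        unfolding G by auto
      then have "eventually (\<lambda>x. \<not> A x) (star f F p)"
        by (simp add: eventually_star R_def ultrafilter_not_iff[OF p(1)])
      then show False
        using A p filter_leD ultrafilter_not_iff unfolding Fp by blast
    qed
    moreover have "star f G G \<le> G"
    proof (rule filter_leI)
      fix P assume "eventually P G"
      then obtain A where A: "eventually A p" "eventually (\<lambda>x. R A x \<longrightarrow> P x) F"
        unfolding G by blast
      have "eventually (\<lambda>x. eventually (\<lambda>y. R A (f x y) \<longrightarrow> P (f x y)) F) F"
        using A(2) FF eventually_star[of "\<lambda>x. R A x \<longrightarrow> P x" f F F] by simp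
      \<comment> \<open>For \<open>x\<close> with \<open>R A x\<close>, the preimage of
        \<open>A\<close> under \<open>f x\<close> is in \<open>p\<close> and can witness membership
        in \<open>G\<close>; by associativity its \<open>R\<close> at \<open>y\<close> is
        \<open>R A (f x y)\<close>.\<close>
      then have "eventually (\<lambda>x. R A x \<longrightarrow> eventually (\<lambda>y. P (f x y)) G) F"
      proof (rule eventually_mono, intro impI)
        fix x
        assume "eventually (\<lambda>y. R A (f x y) \<longrightarrow> P (f x y)) F" and "R A x"
        then show "eventually (\<lambda>y. P (f x y)) G"
          unfolding G by (intro exI[of _ "\<lambda>y. A (f x y)"]) (simp add: R_def assoc)
      qed
      then show "eventually P (star f G G)"
        unfolding eventually_star using A(1) by (intro iffD2[OF G] exI[of _ A] conjI)
    qed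
    ultimately show "G \<noteq> bot \<and> star f G G \<le> G"
      by (simp add: trivial_limit_def)
    show "G \<le> F"
      by (rule filter_leI, subst G, rule exI[of _ "\<lambda>_. True"]) (auto elim: eventually_mono)
  qed
  have "F \<le> p"
  proof (rule filter_leI)
    fix A assume "eventually A p"
    then have "eventually (R A) G"
      unfolding G by (intro exI[of _ A]) simp
    then have "eventually A (star f F p)"
      using \<open>G = F\<close> by (simp add: eventually_star R_def[abs_def])
    then show "eventually A F"
      by (simp add: Fp)
  qed
  then have "F = p"
    using p by simp
  then show thesis
    using that p F FF by blast
qed

text \<open>For an idempotent \<open>p\<close> this is the set usually written as \<open>A\<close>
  with a star: the points of \<open>A\<close> by which the translate of \<open>A\<close> back still
  belongs to \<open>p\<close>.\<close>

definition stable :: "('a \<Rightarrow> 'a \<Rightarrow> 'a) \<Rightarrow> 'a filter \<Rightarrow> ('a \<Rightarrow> bool) \<Rightarrow> 'a \<Rightarrow> bool" where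
  "stable f p P x \<longleftrightarrow> P x \<and> eventually (\<lambda>y. P (f x y)) p"

lemma eventually_stable:
  assumes "star f p p = p" and "eventually P p"
  shows "eventually (stable f p P) p"
proof -
  have "eventually (\<lambda>x. eventually (\<lambda>y. P (f x y)) p) p"
    using assms eventually_star[of P f p p] by simp
  then show ?thesis
    unfolding stable_def[abs_def] by (rule eventually_conj[OF assms(2)])
qed

text \<open>The gain over \<open>P\<close>: by idempotence, almost every \<open>y\<close> that keeps
  \<open>f x y\<close> in \<open>P\<close> also keeps it stable, so the extension can be
  iterated.\<close>

lemma stable_shift:
  assumes assoc: "\<And>x y z. f (f x y) z = f x (f y z)"
    and p: "star f p p = p" and x: "stable f p P x"
  shows "eventually (\<lambda>y. stable f p P (f x y)) p"
proof -
  have "eventually (\<lambda>y. P (f x y)) p"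
    using x by (simp add: stable_def)
  moreover from this have "eventually (\<lambda>y. eventually (\<lambda>z. P (f (f x y) z)) p) p"
    using eventually_star[of "\<lambda>y. P (f x y)" f p p] by (simp add: p assoc)
  ultimately show ?thesis
    unfolding stable_def by (rule eventually_conj)
qed

section \<open>Ultrafilters of rich sets\<close>

context carried_comm_monoid
begin

text \<open>The filter dual to the ideal of non-rich sets, an ideal by \<open>rich_Un\<close>. An
  ultrafilter lies below it exactly when all its members are rich.\<close>

definition rich_filter :: "'a filter" where
  "rich_filter = Abs_filter (\<lambda>P. \<not> rich {x. \<not> P x})"

lemma eventually_rich_filter: "eventually P rich_filter \<longleftrightarrow> \<not> rich {x. \<not> P x}"
  unfolding rich_filter_def
proof (rule eventually_Abs_filter, rule is_filter.intro)
  show "\<not> rich {x. \<not> True}"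
    using not_rich_empty by simp
  fix P Q
  assume "\<not> rich {x. \<not> P x}" "\<not> rich {x. \<not> Q x}"
  then show "\<not> rich {x. \<not> (P x \<and> Q x)}"
    using rich_Un[of "{x. \<not> P x}" "{x. \<not> Q x}"] unfolding de_Morgan_conj Collect_disj_eq by blast
next
  fix P Q
  assume "\<forall>x. P x \<longrightarrow> Q x" "\<not> rich {x. \<not> P x}"
  then show "\<not> rich {x. \<not> Q x}"
    using rich_mono[of "{x. \<not> Q x}" "{x. \<not> P x}"] by blast
qed

lemma rich_carrier: "rich D"
proof -
  have "rich_within D k 1" for k
    unfolding rich_within_def
  proof (intro allI impI)
    fix g :: "nat \<Rightarrow> nat \<Rightarrow> 'a"
    assume g: "\<forall>i<k. \<forall>t. g i t \<in> D"
    obtain a where "a \<in> D"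
      using carrier_nonempty by blast
    then show "\<exists>a \<in> D. \<exists>H \<subseteq> {..<1}. H \<noteq> {} \<and> (\<forall>i<k. a \<^bold>* F (g i) H \<in> D)"
      using g by (intro bexI[of _ a] exI[of _ "{0}"]) (auto simp: carrier_closed)
  qed
  then show ?thesis
    unfolding rich_def by blast
qed

lemma rich_filter_neq_bot: "rich_filter \<noteq> bot"
proof -
  have "rich UNIV"
    by (rule rich_mono[OF rich_carrier]) simp
  then show ?thesis
    using eventually_rich_filter[of "\<lambda>_. False"] by (simp add: trivial_limit_def)
qed

lemma eventually_in_carrier: "eventually (\<lambda>x. x \<in> D) rich_filter"
proof -
  have "{x. x \<notin> D} \<inter> D = {}"
    by blast
  then show ?thesis
    using rich_Int_carrier[of "{x. x \<notin> D}"] not_rich_empty by (auto simp: eventually_rich_filter)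
qed

lemma rich_filter_shift:
  "eventually P rich_filter \<Longrightarrow> x \<in> D \<Longrightarrow> eventually (\<lambda>y. P (x \<^bold>* y)) rich_filter"
  using rich_translate[of x "{x. \<not> P x}"] by (auto simp: eventually_rich_filter)

text \<open>Makes Ellis' lemma applicable: almost every \<open>x\<close> lies in the carrier, and
  translation by such an \<open>x\<close> preserves the filter.\<close>

lemma star_rich_filter: "star (\<^bold>*) rich_filter rich_filter \<le> rich_filter"
proof (rule filter_leI)
  fix P assume P: "eventually P rich_filter"
  show "eventually P (star (\<^bold>*) rich_filter rich_filter)"
    unfolding eventually_star
    by (rule eventually_mono[OF eventually_in_carrier]) (rule rich_filter_shift[OF P])
qed

lemma rich_ultrafilterD:
  assumes "ultrafilter p" "p \<le> rich_filter" "eventually P p"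
  shows "rich {x. P x}"
proof (rule ccontr)
  assume "\<not> rich {x. P x}"
  then have "eventually (\<lambda>x. \<not> P x) rich_filter"
    by (simp add: eventually_rich_filter)
  then show False
    using assms filter_leD ultrafilter_not_iff by blast
qed

end


section \<open>Addition and multiplication of positive integers\<close>

interpretation additive: carried_comm_monoid "(+)" "0::nat" "{1..}"
  rewrites "comm_monoid_set.F (+) (0::nat) = sum"
proof -
  show "carried_comm_monoid (+) (0::nat) {1..}"
    by unfold_locales auto
  show "comm_monoid_set.F (+) (0::nat) = sum"
    by (simp add: sum_def)
qed

interpretation multiplicative: carried_comm_monoid "(*)" "1::nat" "{1..}"
  rewrites "comm_monoid_set.F (*) (1::nat) = prod"
proof -
  show "carried_comm_monoid (*) (1::nat) {1..}"
    by unfold_locales auto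
  show "comm_monoid_set.F (*) (1::nat) = prod"
    by (simp add: prod_def)
qed

text \<open>Two of the \<open>n\<^sup>k + 1\<close> vectors of partial sums modulo \<open>n\<close> agree.\<close>

lemma interval_sums_dvd:
  fixes g :: "nat \<Rightarrow> nat \<Rightarrow> nat"
  assumes n: "n \<ge> 1"
  shows "\<exists>u v. u < v \<and> v \<le> n ^ k \<and> (\<forall>i<k. n dvd (\<Sum>t = u..<v. g i t))"
proof -
  define \<phi> where "\<phi> m = restrict (\<lambda>i. (\<Sum>t = 0..<m. g i t) mod n) {..<k}" for m
  have "\<phi> ` {..n ^ k} \<subseteq> {..<k} \<rightarrow>\<^sub>E {..<n}"
    using n unfolding \<phi>_def by (intro image_subsetI) (simp add: restrict_PiE_iff)
  then have "card (\<phi> ` {..n ^ k}) \<le> card ({..<k} \<rightarrow>\<^sub>E {..<n})"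
    by (intro card_mono finite_PiE) auto
  also have "\<dots> < card {..n ^ k}"
    by (simp add: card_PiE)
  finally have "\<not> inj_on \<phi> {..n ^ k}"
    by (rule pigeonhole)
  then obtain u v where uv: "\<phi> u = \<phi> v" "u < v" "v \<le> n ^ k"
    unfolding inj_on_def by (metis atMost_iff nat_neq_iff)
  have "n dvd (\<Sum>t = u..<v. g i t)" if "i < k" for i
  proof -
    have "(\<Sum>t = 0..<u. g i t) mod n = (\<Sum>t = 0..<v. g i t) mod n"
      using fun_cong[OF uv(1), of i] that by (simp add: \<phi>_def)
    moreover have "(\<Sum>t = 0..<v. g i t) = (\<Sum>t = 0..<u. g i t) + (\<Sum>t = u..<v. g i t)"
      using uv by (simp add: sum.atLeastLessThan_concat)
    ultimately show ?thesis
      using mod_eq_dvd_iff_nat[of "\<Sum>t = 0..<u. g i t" "\<Sum>t = 0..<v. g i t" n] by simp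
  qed
  then show ?thesis
    using uv by blast
qed

text \<open>Every interval of length \<open>n ^ k\<close> contains a subinterval on which all
  \<open>k\<close> sums are divisible by \<open>n\<close>. Richness of the preimage is applied to
  the quotients \<open>g'\<close>; multiplying by \<open>n\<close> gives the translate
  \<open>n * a\<close> and a union of subintervals, so \<open>r\<close> grows by the factor
  \<open>n ^ k\<close>.\<close>

lemma additive_rich_dilate:
  assumes "additive.rich {x. n * x \<in> A}" and n: "n \<ge> 1"
  shows "additive.rich A"
proof -
  have "additive.rich_within A k (r * n ^ k)" if r: "additive.rich_within {x. n * x \<in> A} k r" for k r
    unfolding additive.rich_within_def
  proof (intro allI impI)
    fix g :: "nat \<Rightarrow> nat \<Rightarrow> nat"
    assume g: "\<forall>i<k. \<forall>t. g i t \<in> {1..}"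
    let ?L = "n ^ k"
    have "\<forall>j. \<exists>u v. u < v \<and> v \<le> ?L \<and> (\<forall>i<k. n dvd (\<Sum>t = u..<v. g i (j * ?L + t)))"
      by (intro allI interval_sums_dvd n)
    then obtain u v where uv: "\<And>j. u j < v j" "\<And>j. v j \<le> ?L" and
      dvd: "\<And>j i. i < k \<Longrightarrow> n dvd (\<Sum>t = u j..<v j. g i (j * ?L + t))"
      by metis
    define V where "V j = (\<lambda>t. j * ?L + t) ` {u j..<v j}" for j
    have V_div: "x div ?L = j" if "x \<in> V j" for x j
    proof -
      obtain t where "x = j * ?L + t" "t \<in> {u j..<v j}"
        using \<open>x \<in> V j\<close> unfolding V_def by blast
      then show ?thesis
        using uv(2)[of j] n by simp
    qed
    have V: "disjoint_blocks r (r * ?L) V"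
    proof -
      have "V j \<noteq> {}" for j
        using uv(1)[of j] by (simp add: V_def)
      moreover have "x < r * ?L" if "x \<in> V j" "j < r" for x j
        using div_less_iff_less_mult[of ?L x r] V_div[OF that(1)] that(2) n by simp
      moreover have "V j \<inter> V j' = {}" if "j \<noteq> j'" for j j'
        using V_div that by blast
      ultimately show ?thesis
        unfolding disjoint_blocks_def by blast
    qed
    have sum_V: "sum (g i) (V j) = (\<Sum>t = u j..<v j. g i (j * ?L + t))" for i j
      unfolding V_def by (subst sum.reindex) (simp_all add: inj_on_def)
    define g' where "g' i j = sum (g i) (V j) div n" for i j
    have g'_eq: "n * g' i j = sum (g i) (V j)" if "i < k" for i j
      using dvd[OF that] by (simp add: g'_def sum_V)
    have g': "\<forall>i<k. \<forall>j. g' i j \<in> {1..}"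
    proof (intro allI impI)
      fix i j assume i: "i < k"
      have "sum (g i) (V j) \<in> {1..}"
        using g i uv(1)[of j] by (intro additive.F_in_carrier) (auto simp: V_def)
      then have "n * g' i j \<noteq> 0"
        by (simp add: g'_eq[OF i])
      then show "g' i j \<in> {1..}"
        by (cases "g' i j") auto
    qed
    obtain a H where a: "a \<ge> 1" and H: "H \<subseteq> {..<r}" "H \<noteq> {}" and
      aH: "\<forall>i<k. n * (a + sum (g' i) H) \<in> A"
      using additive.rich_withinD[OF r g'] by auto
    have "n * a + sum (g i) (\<Union>j \<in> H. V j) \<in> A" if "i < k" for i
    proof -
      have "sum (g i) (\<Union>j \<in> H. V j) = (\<Sum>j \<in> H. n * g' i j)"
        using additive.F_Union_blocks[OF V H(1), of "g i"] that by (simp add: g'_eq)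
      then have "n * a + sum (g i) (\<Union>j \<in> H. V j) = n * (a + sum (g' i) H)"
        by (simp add: sum_distrib_left distrib_left)
      then show ?thesis
        using aH that by simp
    qed
    moreover have "n * a \<in> {1..}"
      using n a by (cases "n * a") auto
    ultimately show "\<exists>a \<in> {1..}. \<exists>H \<subseteq> {..<r * ?L}. H \<noteq> {} \<and> (\<forall>i<k. a + sum (g i) H \<in> A)"
      using Union_blocks(1,2)[OF V H] by blast
  qed
  then show ?thesis
    using assms(1) unfolding additive.rich_def by blast
qed

section \<open>Additive idempotents, their common filter and dilations\<close>

definition additive_idempotents :: "nat filter set" where
  "additive_idempotents =
     {q. ultrafilter q \<and> q \<le> additive.rich_filter \<and> star (+) q q = q}"

lemma additive_idempotents_nonempty: "additive_idempotents \<noteq> {}"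
proof -
  obtain q where "ultrafilter q" "q \<le> additive.rich_filter" "star (+) q q = q"
    by (rule idempotent_ultrafilter_ex[OF _ additive.rich_filter_neq_bot additive.star_rich_filter])
      (auto simp: add.assoc)
  then show ?thesis
    unfolding additive_idempotents_def by blast
qed

text \<open>Multiplication by \<open>n\<close> is an additive homomorphism, so images of idempotents
  are idempotent; their members stay rich by \<open>additive_rich_dilate\<close>.\<close>

lemma additive_idempotents_dilate:
  assumes q: "q \<in> additive_idempotents" and n: "n \<ge> 1"
  shows "filtermap ((*) n) q \<in> additive_idempotents"
proof -
  have ultra: "ultrafilter q" and le: "q \<le> additive.rich_filter" and idem: "star (+) q q = q"
    using q by (auto simp: additive_idempotents_def)
  have "ultrafilter (filtermap ((*) n) q)"
    using ultra by (simp add: ultrafilter_def eventually_filtermap filtermap_bot_iff)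
  moreover have "filtermap ((*) n) q \<le> additive.rich_filter"
  proof (rule filter_leI)
    fix P assume "eventually P additive.rich_filter"
    then have "\<not> additive.rich {x. n * x \<in> {x. \<not> P x}}"
      using additive_rich_dilate[OF _ n] unfolding additive.eventually_rich_filter by blast
    then have "eventually (\<lambda>x. P (n * x)) additive.rich_filter"
      unfolding additive.eventually_rich_filter mem_Collect_eq .
    then show "eventually P (filtermap ((*) n) q)"
      unfolding eventually_filtermap by (rule filter_leD[OF le])
  qed
  moreover have "star (+) (filtermap ((*) n) q) (filtermap ((*) n) q) = filtermap ((*) n) q"
  proof -
    have "eventually P (star (+) (filtermap ((*) n) q) (filtermap ((*) n) q)) \<longleftrightarrow>
        eventually (\<lambda>x. P (n * x)) (star (+) q q)" for P
      by (simp add: eventually_star eventually_filtermap distrib_left)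
    then show ?thesis
      unfolding idem filter_eq_iff eventually_filtermap by blast
  qed
  ultimately show ?thesis
    by (simp add: additive_idempotents_def)
qed

text \<open>The supremum of filters consists of the sets common to all of them. Hence each member of
  an ultrafilter below it belongs to some additive idempotent.\<close>

definition idempotent_filter :: "nat filter" where
  "idempotent_filter = Sup additive_idempotents"

lemma eventually_idempotent_filter:
  "eventually P idempotent_filter \<longleftrightarrow> (\<forall>q \<in> additive_idempotents. eventually P q)"
  by (simp add: idempotent_filter_def eventually_Sup)

lemma idempotent_filter_dilate:
  assumes P: "eventually P idempotent_filter" and n: "n \<ge> 1"
  shows "eventually (\<lambda>x. P (n * x)) idempotent_filter"
  unfolding eventually_idempotent_filter
proof
  fix q assume "q \<in> additive_idempotents"
  then have "eventually P (filtermap ((*) n) q)"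
    using P n additive_idempotents_dilate unfolding eventually_idempotent_filter by blast
  then show "eventually (\<lambda>x. P (n * x)) q"
    by (simp add: eventually_filtermap)
qed

lemma eventually_pos_idempotent_filter: "eventually (\<lambda>x. x \<in> {1..}) idempotent_filter"
  unfolding eventually_idempotent_filter additive_idempotents_def
  using filter_leD[OF _ additive.eventually_in_carrier] by blast

text \<open>Finitely many dilation preimages of a set in the filter are again in the filter and hence
  meet, so the set is multiplicatively thick.\<close>

lemma multiplicative_rich_idempotent_filter:
  assumes P: "eventually P idempotent_filter"
  shows "multiplicative.rich {x. P x}"
proof -
  have "multiplicative.rich_within {x. P x} k 1" for k
    unfolding multiplicative.rich_within_def
  proof (intro allI impI)
    fix g :: "nat \<Rightarrow> nat \<Rightarrow> nat"
    assume g: "\<forall>i<k. \<forall>t. g i t \<in> {1..}"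
    have "eventually (\<lambda>x. P (g i 0 * x)) idempotent_filter" if "i \<in> {..<k}" for i
      using idempotent_filter_dilate[OF P] g that by auto
    then have "eventually (\<lambda>x. (\<forall>i \<in> {..<k}. P (g i 0 * x)) \<and> x \<in> {1..}) idempotent_filter"
      by (intro eventually_conj eventually_pos_idempotent_filter eventually_ball_finite) auto
    moreover have "idempotent_filter \<noteq> bot"
    proof -
      obtain q where "q \<in> additive_idempotents"
        using additive_idempotents_nonempty by blast
      then show ?thesis
        using ultrafilter_neq_bot[of q]
        by (auto simp: trivial_limit_def eventually_idempotent_filter additive_idempotents_def)
    qed
    ultimately obtain x where "\<forall>i \<in> {..<k}. P (g i 0 * x)" "x \<in> {1..}"
      using eventually_happens' by blast
    then show "\<exists>a \<in> {1..}. \<exists>H \<subseteq> {..<1}. H \<noteq> {} \<and> (\<forall>i<k. a * prod (g i) H \<in> {x. P x})"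
      by (intro bexI[of _ x] exI[of _ "{0}"]) (auto simp: mult.commute)
  qed
  then show ?thesis
    unfolding multiplicative.rich_def by blast
qed

text \<open>Ellis' lemma for the infimum of the two filters. It is proper because sets in
  \<open>idempotent_filter\<close> are multiplicatively rich and so cannot be disjoint from a set
  with non-rich complement; both filters are preserved by dilation preimages.\<close>

lemma multiplicative_idempotent_ex:
  obtains p where "ultrafilter p" "p \<le> idempotent_filter" "p \<le> multiplicative.rich_filter"
    "star (*) p p = p"
proof -
  let ?J = "inf idempotent_filter multiplicative.rich_filter"
  have "?J \<noteq> bot"
  proof
    assume "?J = bot"
    then obtain X Y where X: "eventually X idempotent_filter"
      and Y: "eventually Y multiplicative.rich_filter" and XY: "\<And>x. X x \<and> Y x \<Longrightarrow> False"
      using eventually_inf[of "\<lambda>_. False"] by (metis eventually_bot)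
    have "multiplicative.rich {x. \<not> Y x}"
      using multiplicative_rich_idempotent_filter[OF X]
      by (rule multiplicative.rich_mono) (use XY in blast)
    then show False
      using Y unfolding multiplicative.eventually_rich_filter by blast
  qed
  moreover have "star (*) ?J ?J \<le> ?J"
  proof (rule filter_leI)
    fix P assume "eventually P ?J"
    then obtain X Y where X: "eventually X idempotent_filter"
      and Y: "eventually Y multiplicative.rich_filter" and XY: "\<And>x. X x \<and> Y x \<Longrightarrow> P x"
      unfolding eventually_inf by blast
    have "eventually (\<lambda>y. P (x * y)) ?J" if "x \<in> {1..}" for x
      unfolding eventually_inf
      using idempotent_filter_dilate[OF X, of x] multiplicative.rich_filter_shift[OF Y that] XY that
      by (intro exI[of _ "\<lambda>y. X (x * y)"] exI[of _ "\<lambda>y. Y (x * y)"]) simp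
    moreover have "eventually (\<lambda>x. x \<in> {1..}) ?J"
      using eventually_pos_idempotent_filter filter_leD inf_le1 by blast
    ultimately show "eventually P (star (*) ?J ?J)"
      unfolding eventually_star by (rule eventually_mono[rotated])
  qed
  ultimately obtain p where "ultrafilter p" "p \<le> ?J" "star (*) p p = p"
    by (rule idempotent_ultrafilter_ex[rotated]) (auto simp: mult.assoc)
  then show thesis
    using that by simp
qed

section \<open>The recursion along finite sets of sequences\<close>

text \<open>\<open>rich_rich\<close> for the sequences shifted by \<open>n + 1\<close>. The shift
  pushes \<open>H\<close> beyond \<open>n\<close> and avoids the index \<open>0\<close>, where the
  sequences need not be positive.\<close>

lemma common_extension:
  fixes F :: "(nat \<Rightarrow> nat) set"
  assumes F: "finite F" "\<forall>f \<in> F. \<forall>t \<ge> 1. f t \<ge> 1"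
    and P: "additive.rich P" and Q: "multiplicative.rich Q"
  shows "\<exists>a b H. a \<ge> 1 \<and> b \<ge> 1 \<and> finite H \<and> H \<noteq> {} \<and> H \<subseteq> {n<..} \<and>
    (\<forall>f \<in> F. a + sum f H \<in> P \<and> b * prod f H \<in> Q)"
proof -
  have pos: "f (n + 1 + t) \<in> {1..}" if "f \<in> F" for f t
    using F(2) that by simp
  have shift: "sum f ((+) (n + 1) ` H) = (\<Sum>t \<in> H. f (n + 1 + t))"
    "prod f ((+) (n + 1) ` H) = (\<Prod>t \<in> H. f (n + 1 + t))" for f :: "nat \<Rightarrow> nat" and H
    by (subst sum.reindex prod.reindex; simp add: comp_def)+
  show ?thesis
  proof (rule rich_rich[where g = "\<lambda>f t. f (n + 1 + t)" and I = F and D = "{1..}" and P = P and Q = Q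
        and f\<^sub>1 = "(+)" and z\<^sub>1 = 0 and f\<^sub>2 = "(*)" and z\<^sub>2 = 1, folded sum_def prod_def])
    fix a b H
    assume ab: "a \<in> {1::nat..}" "b \<in> {1::nat..}" and H: "finite H" "H \<noteq> {}"
      and PQ: "\<And>f. f \<in> F \<Longrightarrow> a + (\<Sum>t \<in> H. f (n + 1 + t)) \<in> P"
        "\<And>f. f \<in> F \<Longrightarrow> b * (\<Prod>t \<in> H. f (n + 1 + t)) \<in> Q"
    show ?thesis
    proof (intro exI conjI ballI)
      fix f assume "f \<in> F"
      then show "a + sum f ((+) (n + 1) ` H) \<in> P" "b * prod f ((+) (n + 1) ` H) \<in> Q"
        unfolding shift using PQ by blast+
    qed (use ab H in auto)
  qed (use additive.carried_comm_monoid_axioms multiplicative.carried_comm_monoid_axioms P Q F(1) pos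
      in blast)+
qed

lemma fin_subsets_seqsD:
  assumes "F \<in> fin_subsets (seqs {1..})"
  shows "finite F" "F \<noteq> {}" "f \<in> F \<Longrightarrow> t \<ge> 1 \<Longrightarrow> (f t :: nat) \<ge> 1"
proof -
  show "finite F" "F \<noteq> {}"
    using assms by (auto simp: fin_subsets_def Fpow_def)
  assume "f \<in> F" "t \<ge> 1"
  then have "f t \<in> {1..}"
    using assms unfolding fin_subsets_def Fpow_def seqs_def by blast
  then show "f t \<ge> 1"
    by simp
qed

text \<open>\<open>S F\<close> contains all the sums along chains ending in \<open>F\<close>, and \<open>M F\<close> contains all the
  products and mixed values along such chains.\<close>

definition chain_system :: "nat set \<Rightarrow> ((nat \<Rightarrow> nat) set \<Rightarrow> nat) \<Rightarrow> ((nat \<Rightarrow> nat) set \<Rightarrow> nat) \<Rightarrow>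
    ((nat \<Rightarrow> nat) set \<Rightarrow> nat set) \<Rightarrow> ((nat \<Rightarrow> nat) set \<Rightarrow> nat set) \<Rightarrow>
    ((nat \<Rightarrow> nat) set \<Rightarrow> nat set) \<Rightarrow> bool" where
  "chain_system A \<alpha> \<beta> H S M \<longleftrightarrow> (\<forall>F \<in> fin_subsets (seqs Npos).
     \<alpha> F \<ge> 1 \<and> \<beta> F \<ge> 1 \<and> H F \<in> fin_subsets Npos \<and> S F \<subseteq> A \<and> M F \<subseteq> A \<and>
     (\<forall>f \<in> F. \<alpha> F + sum f (H F) \<in> S F \<and> \<beta> F * prod f (H F) \<in> M F) \<and>
     (\<forall>G \<in> fin_subsets (seqs Npos). G \<subset> F \<longrightarrow> Max (H G) < Min (H F) \<and>
        (\<forall>f \<in> F. (\<forall>s \<in> S G. s + (\<alpha> F + sum f (H F)) \<in> S F) \<and>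
                 (\<forall>m \<in> S G \<union> M G. m * (\<beta> F * prod f (H F)) \<in> M F))))"

lemma chain_systemD:
  assumes sys: "chain_system A \<alpha> \<beta> H S M" and F: "F \<in> fin_subsets (seqs Npos)"
  shows "\<alpha> F \<in> Npos" "\<beta> F \<in> Npos" "H F \<in> fin_subsets Npos" "S F \<subseteq> A" "M F \<subseteq> A"
    and "f \<in> F \<Longrightarrow> \<alpha> F + sum f (H F) \<in> S F" and "f \<in> F \<Longrightarrow> \<beta> F * prod f (H F) \<in> M F"
    and "G \<in> fin_subsets (seqs Npos) \<Longrightarrow> G \<subset> F \<Longrightarrow> Max (H G) < Min (H F)"
    and "G \<in> fin_subsets (seqs Npos) \<Longrightarrow> G \<subset> F \<Longrightarrow> f \<in> F \<Longrightarrow> s \<in> S G \<Longrightarrow>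
      s + (\<alpha> F + sum f (H F)) \<in> S F"
    and "G \<in> fin_subsets (seqs Npos) \<Longrightarrow> G \<subset> F \<Longrightarrow> f \<in> F \<Longrightarrow> m \<in> S G \<union> M G \<Longrightarrow>
      m * (\<beta> F * prod f (H F)) \<in> M F"
  unfolding atLeast_iff using bspec[OF sys[unfolded chain_system_def] F] by blast+

text \<open>All that the recursion has to know about the two ultrafilters. Sums are kept in the
  smaller set \<open>B\<close>; as \<open>B \<subseteq> A\<close>, they may afterwards be
  multiplied.\<close>

definition shift_rich :: "nat set \<Rightarrow> nat set \<Rightarrow> bool" where
  "shift_rich A B \<longleftrightarrow> B \<subseteq> A \<and>
     (\<forall>S. finite S \<and> S \<subseteq> B \<longrightarrow> additive.rich {x \<in> B. \<forall>s \<in> S. s + x \<in> B}) \<and>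
     (\<forall>M. finite M \<and> M \<subseteq> A \<longrightarrow> multiplicative.rich {y \<in> A. \<forall>m \<in> M. m * y \<in> A})"

text \<open>Recursion along strict inclusion of finite sets. Each \<open>F\<close> has finitely many
  predecessors with finitely many recorded values, so one application of
  \<open>common_extension\<close> prolongs all earlier chains at once.\<close>

lemma chain_system_ex:
  assumes "shift_rich A B"
  shows "\<exists>\<alpha> \<beta> H S M. chain_system A \<alpha> \<beta> H S M"
proof -
  have BA: "B \<subseteq> A"
    and B: "\<forall>S. finite S \<and> S \<subseteq> B \<longrightarrow> additive.rich {x \<in> B. \<forall>s \<in> S. s + x \<in> B}"
    and A: "\<forall>M. finite M \<and> M \<subseteq> A \<longrightarrow> multiplicative.rich {y \<in> A. \<forall>m \<in> M. m * y \<in> A}"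
    using assms unfolding shift_rich_def by simp_all
  define \<F> :: "(nat \<Rightarrow> nat) set set" where "\<F> = fin_subsets (seqs Npos)"
  define R where "R = {(G, F). G \<in> \<F> \<and> F \<in> \<F> \<and> G \<subset> F}"
  \<comment> \<open>Compared with \<open>chain_system\<close>, sums are kept in \<open>B\<close>,
    and \<open>S\<close> and \<open>M\<close> are kept finite, so that \<open>shift_rich\<close>
    applies at the next stage. Outside the finite sets of sequences every tuple is accepted.\<close>
  define good :: "((nat \<Rightarrow> nat) set \<Rightarrow> nat \<times> nat \<times> nat set \<times> nat set \<times> nat set) \<Rightarrow>
      (nat \<Rightarrow> nat) set \<Rightarrow> nat \<times> nat \<times> nat set \<times> nat set \<times> nat set \<Rightarrow> bool" where
    "good \<Phi> F = (\<lambda>(a, b, H, S, M). F \<in> \<F> \<longrightarrow>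
       a \<ge> 1 \<and> b \<ge> 1 \<and> H \<in> fin_subsets {1..} \<and> S \<subseteq> B \<and> M \<subseteq> A \<and> finite S \<and> finite M \<and>
       (\<forall>f \<in> F. a + sum f H \<in> S \<and> b * prod f H \<in> M) \<and>
       (\<forall>G. (G, F) \<in> R \<longrightarrow> (case \<Phi> G of (_, _, H', S', M') \<Rightarrow>
          Max H' < Min H \<and>
          (\<forall>f \<in> F. (\<forall>s \<in> S'. s + (a + sum f H) \<in> S) \<and>
                   (\<forall>m \<in> S' \<union> M'. m * (b * prod f H) \<in> M)))))" for \<Phi> F
  have "\<exists>\<Phi>. \<forall>F. good \<Phi> F (\<Phi> F)"
  proof (rule dependent_wf_choice)
    have "R \<subseteq> finite_psubset"
      using fin_subsets_seqsD(1) by (auto simp: R_def finite_psubset_def \<F>_def)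
    then show "wf R"
      using wf_finite_psubset wf_subset by blast
    show "good \<Phi> F r = good \<Psi> F r" if "\<And>G. (G, F) \<in> R \<Longrightarrow> \<Phi> G = \<Psi> G" for \<Phi> \<Psi> F r
      unfolding good_def using that by (cases r) auto
  next
    fix F and \<Phi> :: "(nat \<Rightarrow> nat) set \<Rightarrow> nat \<times> nat \<times> nat set \<times> nat set \<times> nat set"
    assume IH: "\<And>G. (G, F) \<in> R \<Longrightarrow> good \<Phi> G (\<Phi> G)"
    show "\<exists>r. good \<Phi> F r"
    proof (cases "F \<in> \<F>")
      case False
      then show ?thesis
        unfolding good_def by auto
    next
      case True
      define Hs where "Hs G = fst (snd (snd (\<Phi> G)))" for G
      define Ss where "Ss G = fst (snd (snd (snd (\<Phi> G))))" for G
      define Ms where "Ms G = snd (snd (snd (snd (\<Phi> G))))" for G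
      have \<Phi>: "\<Phi> G = (fst (\<Phi> G), fst (snd (\<Phi> G)), Hs G, Ss G, Ms G)" for G
        by (simp add: Hs_def Ss_def Ms_def)
      have old: "Hs G \<in> fin_subsets {1..} \<and> Ss G \<subseteq> B \<and> Ms G \<subseteq> A \<and> finite (Ss G) \<and> finite (Ms G)"
        if "(G, F) \<in> R" for G
      proof -
        have "G \<in> \<F>"
          using that by (simp add: R_def)
        then show ?thesis
          using IH[OF that] unfolding good_def by (subst (asm) \<Phi>) auto
      qed
      define Gs where "Gs = {G. (G, F) \<in> R}"
      have "finite F"
        using True fin_subsets_seqsD(1) unfolding \<F>_def by blast
      have finGs: "finite Gs"
        by (rule finite_subset[of _ "Pow F"]) (use \<open>finite F\<close> in \<open>auto simp: Gs_def R_def\<close>)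
      define S0 where "S0 = (\<Union>G \<in> Gs. Ss G)"
      \<comment> \<open>Earlier sums are included because a mixed value starts from a sum and
        continues with products.\<close>
      define M0 where "M0 = (\<Union>G \<in> Gs. Ss G \<union> Ms G)"
      define H0 where "H0 = (\<Union>G \<in> Gs. Hs G)"
      have fin: "finite S0" "finite M0" "finite H0"
        using finGs old unfolding S0_def M0_def H0_def Gs_def
        by (auto simp: fin_subsets_def Fpow_def)
      have sub: "S0 \<subseteq> B" "M0 \<subseteq> A"
        using old BA unfolding S0_def M0_def Gs_def by blast+
      have posF: "\<forall>f \<in> F. \<forall>t \<ge> 1. f t \<ge> 1"
        using fin_subsets_seqsD(3) True unfolding \<F>_def by blast
      have "additive.rich {x \<in> B. \<forall>s \<in> S0. s + x \<in> B}"
        "multiplicative.rich {y \<in> A. \<forall>m \<in> M0. m * y \<in> A}"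
        using A B fin sub by blast+
      \<comment> \<open>The inserted \<open>0\<close> gives the maximum a value when
        \<open>F\<close> has no predecessor and keeps \<open>H\<close> within the positive
        integers.\<close>
      from common_extension[OF \<open>finite F\<close> posF this, of "Max (insert 0 H0)"]
      obtain a b H where ab: "a \<ge> 1" "b \<ge> 1"
        and H: "finite H" "H \<noteq> {}" "H \<subseteq> {Max (insert 0 H0)<..}"
        and xy: "\<forall>f \<in> F. a + sum f H \<in> {x \<in> B. \<forall>s \<in> S0. s + x \<in> B} \<and>
          b * prod f H \<in> {y \<in> A. \<forall>m \<in> M0. m * y \<in> A}"
        by blast
      define X where "X = (\<lambda>f. a + sum f H) ` F"
      define Y where "Y = (\<lambda>f. b * prod f H) ` F"
      define S where "S = X \<union> (\<lambda>(s, x). s + x) ` (S0 \<times> X)"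
      define M where "M = Y \<union> (\<lambda>(m, y). m * y) ` (M0 \<times> Y)"
      have "finite S" "finite M"
        using fin \<open>finite F\<close> by (auto simp: S_def M_def X_def Y_def)
      moreover have "S \<subseteq> B" "M \<subseteq> A"
        using xy by (auto simp: S_def M_def X_def Y_def)
      moreover have "H \<in> fin_subsets {1..}"
        using H by (force simp: fin_subsets_def Fpow_def)
      moreover have "Max (Hs G) < Min H" if "(G, F) \<in> R" for G
      proof -
        have "Hs G \<subseteq> H0" "Hs G \<noteq> {}" "finite (Hs G)"
          using that old[OF that] by (auto simp: H0_def Gs_def fin_subsets_def Fpow_def)
        then have "Max (Hs G) \<in> insert 0 H0"
          using Max_in by blast
        then have "Max (Hs G) \<le> Max (insert 0 H0)"
          using fin by (intro Max_ge) auto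
        also have "Max (insert 0 H0) < Min H"
          using H Min_in[OF H(1,2)] by blast
        finally show ?thesis .
      qed
      moreover have "\<forall>s \<in> Ss G. s + (a + sum f H) \<in> S" if "(G, F) \<in> R" "f \<in> F" for G f
        using that by (force simp: S_def S0_def Gs_def X_def)
      moreover have "\<forall>m \<in> Ss G \<union> Ms G. m * (b * prod f H) \<in> M" if "(G, F) \<in> R" "f \<in> F" for G f
        using that by (force simp: M_def M0_def Gs_def Y_def)
      moreover have "\<forall>f \<in> F. a + sum f H \<in> S \<and> b * prod f H \<in> M"
        by (auto simp: S_def M_def X_def Y_def)
      ultimately have "good \<Phi> F (a, b, H, S, M)"
        unfolding good_def using ab by (subst \<Phi>) auto
      then show ?thesis
        by blast
    qed
  qed
  then obtain \<Phi> where \<Phi>: "\<And>F. good \<Phi> F (\<Phi> F)"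
    by blast
  define \<alpha> where "\<alpha> F = fst (\<Phi> F)" for F
  define \<beta> where "\<beta> F = fst (snd (\<Phi> F))" for F
  define H where "H F = fst (snd (snd (\<Phi> F)))" for F
  define S where "S F = fst (snd (snd (snd (\<Phi> F))))" for F
  define M where "M F = snd (snd (snd (snd (\<Phi> F))))" for F
  have split: "\<Phi> F = (\<alpha> F, \<beta> F, H F, S F, M F)" for F
    by (simp add: \<alpha>_def \<beta>_def H_def S_def M_def)
  have *: "\<alpha> F \<ge> 1 \<and> \<beta> F \<ge> 1 \<and> H F \<in> fin_subsets {1..} \<and> S F \<subseteq> B \<and> M F \<subseteq> A"
    "\<forall>f \<in> F. \<alpha> F + sum f (H F) \<in> S F \<and> \<beta> F * prod f (H F) \<in> M F"
    "\<forall>G. (G, F) \<in> R \<longrightarrow> Max (H G) < Min (H F) \<and>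
       (\<forall>f \<in> F. (\<forall>s \<in> S G. s + (\<alpha> F + sum f (H F)) \<in> S F) \<and>
                (\<forall>m \<in> S G \<union> M G. m * (\<beta> F * prod f (H F)) \<in> M F))" if "F \<in> \<F>" for F
    using \<Phi>[of F] that unfolding good_def split prod.case by blast+
  have "chain_system A \<alpha> \<beta> H S M"
    unfolding chain_system_def
  proof (intro ballI conjI impI)
    fix F :: "(nat \<Rightarrow> nat) set"
    assume "F \<in> fin_subsets (seqs Npos)"
    then have F: "F \<in> \<F>"
      by (simp add: \<F>_def)
    show "\<alpha> F \<ge> 1" "\<beta> F \<ge> 1" "H F \<in> fin_subsets Npos" "S F \<subseteq> A" "M F \<subseteq> A"
      using *(1)[OF F] BA by blast+
    show "\<alpha> F + sum f (H F) \<in> S F" "\<beta> F * prod f (H F) \<in> M F" if "f \<in> F" for f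
      using *(2)[OF F] that by blast+
    fix G :: "(nat \<Rightarrow> nat) set"
    assume "G \<in> fin_subsets (seqs Npos)" "G \<subset> F"
    then have GF: "(G, F) \<in> R"
      using F by (simp add: R_def \<F>_def)
    show "Max (H G) < Min (H F)"
      using *(3)[OF F] GF by blast
    show "s + (\<alpha> F + sum f (H F)) \<in> S F" if "f \<in> F" "s \<in> S G" for f s
      using *(3)[OF F] GF that by blast
    show "m * (\<beta> F * prod f (H F)) \<in> M F" if "f \<in> F" "m \<in> S G \<union> M G" for f m
      using *(3)[OF F] GF that by blast
  qed
  then show ?thesis
    by blast
qed

section \<open>Values along chains\<close>

lemma chain_system_values:
  fixes G :: "nat \<Rightarrow> (nat \<Rightarrow> nat) set" and f :: "nat \<Rightarrow> nat \<Rightarrow> nat"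
  assumes sys: "chain_system A \<alpha> \<beta> H S M"
    and G: "\<forall>i \<in> {1..m}. G i \<in> fin_subsets (seqs Npos)" and chain: "\<forall>i \<in> {1..<m}. G i \<subset> G (i + 1)"
    and f: "\<forall>i \<in> {1..m}. f i \<in> G i"
  defines "x \<equiv> \<lambda>i. \<alpha> (G i) + sum (f i) (H (G i))"
    and "y \<equiv> \<lambda>i. \<beta> (G i) * prod (f i) (H (G i))"
  shows "1 \<le> N \<Longrightarrow> N \<le> m \<Longrightarrow> (\<Sum>i = 1..N. x i) \<in> A"
    and "1 \<le> N \<Longrightarrow> N \<le> m \<Longrightarrow> (\<Prod>i = 1..N. y i) \<in> A"
    and "1 \<le> N \<Longrightarrow> N \<le> m \<Longrightarrow> (\<Sum>i = 1..N. x i) * (\<Prod>i = N + 1..m. y i) \<in> A"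
proof -
  have SM: "S (G j) \<subseteq> A" "M (G j) \<subseteq> A" "x j \<in> S (G j)" "y j \<in> M (G j)" if "1 \<le> j" "j \<le> m" for j
  proof -
    have "G j \<in> fin_subsets (seqs Npos)" "f j \<in> G j"
      using G f that by simp_all
    then show "S (G j) \<subseteq> A" "M (G j) \<subseteq> A" "x j \<in> S (G j)" "y j \<in> M (G j)"
      unfolding x_def y_def using chain_systemD[OF sys] by simp_all
  qed
  have next_index: "G (Suc j) \<in> fin_subsets (seqs Npos)" "G j \<in> fin_subsets (seqs Npos)"
    "G j \<subset> G (Suc j)" "f (Suc j) \<in> G (Suc j)" if "1 \<le> j" "Suc j \<le> m" for j
    using G chain f that by auto
  have step_S: "s + x (Suc j) \<in> S (G (Suc j))" if "1 \<le> j" "Suc j \<le> m" "s \<in> S (G j)" for j s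
    unfolding x_def using chain_systemD(9)[OF sys next_index[OF that(1,2)] that(3)] .
  have step_M: "v * y (Suc j) \<in> M (G (Suc j))"
    if "1 \<le> j" "Suc j \<le> m" "v \<in> S (G j) \<union> M (G j)" for j v
    unfolding y_def using chain_systemD(10)[OF sys next_index[OF that(1,2)] that(3)] .
  have sums: "(\<Sum>i = 1..N. x i) \<in> S (G N)" if "1 \<le> N" "N \<le> m" for N
    using that
  proof (induction N rule: dec_induct)
    case base
    then show ?case
      using SM(3)[of 1] by simp
  next
    case (step N)
    then have N: "Suc N \<le> m" "(\<Sum>i = 1..N. x i) \<in> S (G N)"
      by simp_all
    have "(\<Sum>i = 1..N. x i) + x (Suc N) \<in> S (G (Suc N))"
      using step(1) N by (intro step_S)
    then show ?case
      by simp
  qed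
  have prods: "(\<Prod>i = 1..N. y i) \<in> M (G N)" if "1 \<le> N" "N \<le> m" for N
    using that
  proof (induction N rule: dec_induct)
    case base
    then show ?case
      using SM(4)[of 1] by simp
  next
    case (step N)
    then have N: "Suc N \<le> m" "(\<Prod>i = 1..N. y i) \<in> S (G N) \<union> M (G N)"
      by simp_all
    have "(\<Prod>i = 1..N. y i) * y (Suc N) \<in> M (G (Suc N))"
      using step(1) N by (intro step_M)
    then show ?case
      by simp
  qed
  \<comment> \<open>At \<open>j = N\<close> the product is empty and the value is a sum in
    \<open>S (G N)\<close>; the first factor moves it into \<open>M\<close>, where it remains. The
    union covers both situations.\<close>
  have mixed: "(\<Sum>i = 1..N. x i) * (\<Prod>i = N + 1..j. y i) \<in> S (G j) \<union> M (G j)"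
    if "N \<le> j" "1 \<le> N" "j \<le> m" for N j
    using that
  proof (induction j rule: dec_induct)
    case base
    then show ?case
      using sums by simp
  next
    case (step j)
    then have j: "1 \<le> j" "Suc j \<le> m" "(\<Sum>i = 1..N. x i) * (\<Prod>i = N + 1..j. y i) \<in> S (G j) \<union> M (G j)"
      by simp_all
    have "(\<Sum>i = 1..N. x i) * (\<Prod>i = N + 1..j. y i) * y (Suc j) \<in> M (G (Suc j))"
      using j by (intro step_M)
    moreover have "(\<Prod>i = N + 1..Suc j. y i) = (\<Prod>i = N + 1..j. y i) * y (Suc j)"
      using step(1) by simp
    ultimately show ?case
      by (simp only: mult.assoc Un_iff simp_thms)
  qed
  show "(\<Sum>i = 1..N. x i) \<in> A" "(\<Prod>i = 1..N. y i) \<in> A" if "1 \<le> N" "N \<le> m"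
    using sums[OF that] prods[OF that] SM(1,2)[OF that] by blast+
  show "(\<Sum>i = 1..N. x i) * (\<Prod>i = N + 1..m. y i) \<in> A" if "1 \<le> N" "N \<le> m"
    using mixed[OF that(2,1) order_refl] SM(1,2)[of m] that by auto
qed

section \<open>Choice of the colour class and conclusion\<close>

lemma shift_rich_color_ex:
  assumes "finite C" and "\<Union>C = Npos"
  shows "\<exists>A \<in> C. \<exists>A' B. A' \<subseteq> A \<and> shift_rich A' B"
proof -
  obtain p where p: "ultrafilter p" "p \<le> idempotent_filter" "p \<le> multiplicative.rich_filter"
    and pp: "star (*) p p = p"
    by (rule multiplicative_idempotent_ex)
  have "\<exists>A \<in> C. eventually (\<lambda>x. x \<in> A) p"
  proof (rule ccontr)
    assume "\<not> ?thesis"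
    then have "\<forall>A \<in> C. eventually (\<lambda>x. x \<notin> A) p"
      using ultrafilter_not_iff[OF p(1)] by blast
    then have "eventually (\<lambda>x. \<forall>A \<in> C. x \<notin> A) p"
      using assms(1) by (intro eventually_ball_finite)
    moreover have "eventually (\<lambda>x. x \<in> Npos) p"
      using filter_leD[OF p(3) multiplicative.eventually_in_carrier] .
    ultimately have "eventually (\<lambda>x. False) p"
      by eventually_elim (use assms(2) in blast)
    then show False
      using ultrafilter_neq_bot[OF p(1)] by (simp add: trivial_limit_def)
  qed
  then obtain A where A: "A \<in> C" "eventually (\<lambda>x. x \<in> A) p"
    by blast
  define A' where "A' = {x. stable (*) p (\<lambda>x. x \<in> A) x}"
  have A'_p: "eventually (\<lambda>x. x \<in> A') p"
    using eventually_stable[OF pp A(2)] by (simp add: A'_def)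
  have A'_shift: "eventually (\<lambda>y. m * y \<in> A') p" if "m \<in> A'" for m
    using stable_shift[OF mult.assoc pp, of "\<lambda>x. x \<in> A" m] that by (simp add: A'_def)
  \<comment> \<open>If every additive idempotent contained the complement of \<open>A'\<close>, so
    would \<open>p\<close>, which lies below \<open>idempotent_filter\<close>. Hence some
    \<open>q\<close> contains \<open>A'\<close>, and stabilising \<open>A'\<close> under addition
    along \<open>q\<close> gives \<open>B\<close>.\<close>
  have "\<not> eventually (\<lambda>x. x \<notin> A') idempotent_filter"
    using A'_p filter_leD[OF p(2)] ultrafilter_not_iff[OF p(1)] by blast
  then obtain q where q: "q \<in> additive_idempotents" and A'_q: "\<not> eventually (\<lambda>x. x \<notin> A') q"
    unfolding eventually_idempotent_filter by blast
  have uq: "ultrafilter q" and leq: "q \<le> additive.rich_filter" and qq: "star (+) q q = q"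
    using q by (simp_all add: additive_idempotents_def)
  have A'_q': "eventually (\<lambda>x. x \<in> A') q"
    using A'_q uq by (auto simp: ultrafilter_def)
  define B where "B = {x. stable (+) q (\<lambda>x. x \<in> A') x}"
  have B_q: "eventually (\<lambda>x. x \<in> B) q"
    using eventually_stable[OF qq A'_q'] by (simp add: B_def)
  have B_shift: "eventually (\<lambda>x. s + x \<in> B) q" if "s \<in> B" for s
    using stable_shift[OF add.assoc qq, of "\<lambda>x. x \<in> A'" s] that by (simp add: B_def)
  have "A' \<subseteq> A" "B \<subseteq> A'"
    by (auto simp: A'_def B_def stable_def)
  have "additive.rich {x \<in> B. \<forall>s \<in> S. s + x \<in> B}" if "finite S" "S \<subseteq> B" for S
  proof -
    have "eventually (\<lambda>x. x \<in> B \<and> (\<forall>s \<in> S. s + x \<in> B)) q"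
      using B_shift that by (intro eventually_conj B_q eventually_ball_finite) auto
    then show ?thesis
      by (rule additive.rich_ultrafilterD[OF uq leq])
  qed
  moreover have "multiplicative.rich {y \<in> A'. \<forall>m \<in> M. m * y \<in> A'}" if "finite M" "M \<subseteq> A'" for M
  proof -
    have "eventually (\<lambda>y. y \<in> A' \<and> (\<forall>m \<in> M. m * y \<in> A')) p"
      using A'_shift that by (intro eventually_conj A'_p eventually_ball_finite) auto
    then show ?thesis
      by (rule multiplicative.rich_ultrafilterD[OF p(1,3)])
  qed
  ultimately have "shift_rich A' B"
    using \<open>B \<subseteq> A'\<close> unfolding shift_rich_def by simp
  then show ?thesis
    using A(1) \<open>A' \<subseteq> A\<close> by blast
qed

theorem theorem1p3:
  fixes C :: "nat set set"
  assumes "finite_coloring C"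
  shows "\<exists>A \<in> C.
    \<exists>\<alpha> \<in> fin_subsets (seqs Npos) \<rightarrow> Npos.
    \<exists>\<beta> \<in> fin_subsets (seqs Npos) \<rightarrow> Npos.
    \<exists>H \<in> fin_subsets (seqs Npos) \<rightarrow> fin_subsets Npos.
      (\<forall>F \<in> fin_subsets (seqs Npos). \<forall>G \<in> fin_subsets (seqs Npos).
         F \<subset> G \<longrightarrow> Max (H F) < Min (H G)) \<and>
      (\<forall>m \<in> Npos. \<forall>(G :: nat \<Rightarrow> (nat \<Rightarrow> nat) set) (f :: nat \<Rightarrow> nat \<Rightarrow> nat).
         (\<forall>i \<in> {1..m}. G i \<in> fin_subsets (seqs Npos)) \<and>
         (\<forall>i \<in> {1..<m}. G i \<subset> G (i + 1)) \<and>
         (\<forall>i \<in> {1..m}. f i \<in> G i) \<longrightarrow>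
           (\<Sum>i = 1..m. \<alpha> (G i) + (\<Sum>t \<in> H (G i). f i t)) \<in> A \<and>
           (\<Prod>i = 1..m. \<beta> (G i) * (\<Prod>t \<in> H (G i). f i t)) \<in> A \<and>
           (\<forall>N \<in> Npos. N \<le> m \<longrightarrow>
              (\<Sum>i = 1..N. \<alpha> (G i) + (\<Sum>t \<in> H (G i). f i t)) *
              (\<Prod>i = N + 1..m. \<beta> (G i) * (\<Prod>t \<in> H (G i). f i t)) \<in> A))"
proof -
  have "finite C" "\<Union>C = Npos"
    using assms by (auto simp: finite_coloring_def partition_on_def)
  from shift_rich_color_ex[OF this] obtain A A' B where "A \<in> C" and sub: "A' \<subseteq> A" and "shift_rich A' B"
    by blast
  from chain_system_ex[OF this(3)] obtain \<alpha> \<beta> H S M where sys: "chain_system A' \<alpha> \<beta> H S M"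
    by blast
  show ?thesis
  proof (rule bexI[of _ A], rule bexI[of _ \<alpha>], rule bexI[of _ \<beta>], rule bexI[of _ H],
      intro conjI ballI allI impI)
    show "A \<in> C"
      by fact
    show "\<alpha> \<in> fin_subsets (seqs Npos) \<rightarrow> Npos" "\<beta> \<in> fin_subsets (seqs Npos) \<rightarrow> Npos"
      "H \<in> fin_subsets (seqs Npos) \<rightarrow> fin_subsets Npos"
      using chain_systemD(1-3)[OF sys] by blast+
    show "Max (H F) < Min (H G)"
      if "F \<in> fin_subsets (seqs Npos)" "G \<in> fin_subsets (seqs Npos)" "F \<subset> G" for F G
      using chain_systemD(8)[OF sys that(2,1,3)] .
    fix m and G :: "nat \<Rightarrow> (nat \<Rightarrow> nat) set" and f :: "nat \<Rightarrow> nat \<Rightarrow> nat"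
    assume "m \<in> Npos" and "(\<forall>i \<in> {1..m}. G i \<in> fin_subsets (seqs Npos)) \<and>
         (\<forall>i \<in> {1..<m}. G i \<subset> G (i + 1)) \<and> (\<forall>i \<in> {1..m}. f i \<in> G i)"
    then have m: "1 \<le> m" and G: "\<forall>i \<in> {1..m}. G i \<in> fin_subsets (seqs Npos)"
      "\<forall>i \<in> {1..<m}. G i \<subset> G (i + 1)" "\<forall>i \<in> {1..m}. f i \<in> G i"
      by simp_all
    show "(\<Sum>i = 1..m. \<alpha> (G i) + (\<Sum>t \<in> H (G i). f i t)) \<in> A"
      using chain_system_values(1)[OF sys G m order_refl] sub by (rule subsetD[rotated])
    show "(\<Prod>i = 1..m. \<beta> (G i) * (\<Prod>t \<in> H (G i). f i t)) \<in> A"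
      using chain_system_values(2)[OF sys G m order_refl] sub by (rule subsetD[rotated])
    show "(\<Sum>i = 1..N. \<alpha> (G i) + (\<Sum>t \<in> H (G i). f i t)) *
        (\<Prod>i = N + 1..m. \<beta> (G i) * (\<Prod>t \<in> H (G i). f i t)) \<in> A" if "N \<in> Npos" "N \<le> m" for N
      using chain_system_values(3)[OF sys G _ that(2)] that(1) sub by (meson atLeast_iff subsetD)
  qed
qed

end
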